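(* Let $I\in\mathbb{S}$ and let $\phi,\psi\in L^2(\mathbb{R},\mathbb{H})$. Then $$\langle\mathcal{F}_I(\phi),\mathcal{F}_I(\psi)\rangle_{L^2(\mathbb{R},\mathbb{H})}=\langle\phi,\psi\rangle_{L^2(\mathbb{R},\mathbb{H})}.$$ In particular, for any $\phi\in L^2(\mathbb{R},\mathbb{H})$, $$\|\mathcal{F}_I(\phi)\|_{L^2(\mathbb{R},\mathbb{H})}=\|\phi\|_{L^2(\mathbb{R},\mathbb{H})}.$$
   Context: $\mathbb{H}$ is the algebra of real quaternions, $\mathbb{S}=\{q\in\mathbb{H}:q^2=-1\}$. $L^2(\mathbb{R},\mathbb{H})$ is the space of square integrable $\mathbb{H}$-valued functions with inner product $\langle\psi,\phi\rangle=\int_{\mathbb{R}}\overline{\phi(t)}\psi(t)\,dt$. For a given $I\in\mathbb{S}$, the left sided 1D quaternion Fourier transform of $\psi\in L^1(\mathbb{R},\mathbb{H})$ is $$\mathcal{F}_I(\psi)(\omega)=\int_{\mathbb{R}}e^{-2\pi I\omega t}\psi(t)\,dt.$$ On $L^2(\mathbb{R},\mathbb{H})$, $\mathcal{F}_I$ is understood, as usual, as the continuous extension from $L^1\cap L^2$. *)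

theory Defs
  imports "HOL-Analysis.Analysis"
begin

datatype quat = Quat (qre: real) (qim1: real) (qim2: real) (qim3: real)

lemma quat_eq_iff:
  "x = y \<longleftrightarrow> qre x = qre y \<and> qim1 x = qim1 y \<and> qim2 x = qim2 y \<and> qim3 x = qim3 y"
  by (cases x; cases y) simp

instantiation quat :: real_vector
begin

definition "0 = Quat 0 0 0 0"
definition "x + y = Quat (qre x + qre y) (qim1 x + qim1 y) (qim2 x + qim2 y) (qim3 x + qim3 y)"
definition "x - y = Quat (qre x - qre y) (qim1 x - qim1 y) (qim2 x - qim2 y) (qim3 x - qim3 y)"
definition "- x = Quat (- qre x) (- qim1 x) (- qim2 x) (- qim3 x)"
definition "r *\<^sub>R x = Quat (r * qre x) (r * qim1 x) (r * qim2 x) (r * qim3 x)"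

instance
  by standard
    (simp_all add: quat_eq_iff zero_quat_def plus_quat_def minus_quat_def uminus_quat_def
      scaleR_quat_def distrib_left distrib_right)

end

lemma quat_vector_sel [simp]:
  "qre 0 = 0" "qim1 0 = 0" "qim2 0 = 0" "qim3 0 = 0"
  "qre (x + y) = qre x + qre y" "qim1 (x + y) = qim1 x + qim1 y"
  "qim2 (x + y) = qim2 x + qim2 y" "qim3 (x + y) = qim3 x + qim3 y"
  "qre (x - y) = qre x - qre y" "qim1 (x - y) = qim1 x - qim1 y"
  "qim2 (x - y) = qim2 x - qim2 y" "qim3 (x - y) = qim3 x - qim3 y"
  "qre (- x) = - qre x" "qim1 (- x) = - qim1 x"
  "qim2 (- x) = - qim2 x" "qim3 (- x) = - qim3 x"
  "qre (r *\<^sub>R x) = r * qre x" "qim1 (r *\<^sub>R x) = r * qim1 x"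
  "qim2 (r *\<^sub>R x) = r * qim2 x" "qim3 (r *\<^sub>R x) = r * qim3 x"
  by (simp_all add: zero_quat_def plus_quat_def minus_quat_def uminus_quat_def scaleR_quat_def)

instantiation quat :: real_algebra_1
begin

definition "1 = Quat 1 0 0 0"
definition "x * y = Quat
  (qre x * qre y - qim1 x * qim1 y - qim2 x * qim2 y - qim3 x * qim3 y)
  (qre x * qim1 y + qim1 x * qre y + qim2 x * qim3 y - qim3 x * qim2 y)
  (qre x * qim2 y - qim1 x * qim3 y + qim2 x * qre y + qim3 x * qim1 y)
  (qre x * qim3 y + qim1 x * qim2 y - qim2 x * qim1 y + qim3 x * qre y)"

instance
  by standard (auto simp: quat_eq_iff one_quat_def times_quat_def algebra_simps)

end

lemma quat_algebra_sel [simp]: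
  "qre 1 = 1" "qim1 1 = 0" "qim2 1 = 0" "qim3 1 = 0"
  "qre (x * y) = qre x * qre y - qim1 x * qim1 y - qim2 x * qim2 y - qim3 x * qim3 y"
  "qim1 (x * y) = qre x * qim1 y + qim1 x * qre y + qim2 x * qim3 y - qim3 x * qim2 y"
  "qim2 (x * y) = qre x * qim2 y - qim1 x * qim3 y + qim2 x * qre y + qim3 x * qim1 y"
  "qim3 (x * y) = qre x * qim3 y + qim1 x * qim2 y - qim2 x * qim1 y + qim3 x * qre y"
  by (simp_all add: one_quat_def times_quat_def)

instantiation quat :: real_inner
begin

definition "inner x y = qre x * qre y + qim1 x * qim1 y + qim2 x * qim2 y + qim3 x * qim3 y"
definition "norm (x :: quat) = sqrt (inner x x)"
definition "dist x y = norm (x - y :: quat)"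
definition "sgn x = x /\<^sub>R norm (x :: quat)"
definition "uniformity = (INF e\<in>{0<..}. principal {(x :: quat, y). dist x y < e})"
definition "open (U :: quat set) \<longleftrightarrow>
  (\<forall>x\<in>U. eventually (\<lambda>(x', y). x' = x \<longrightarrow> y \<in> U) uniformity)"

instance
proof
  fix x y z :: quat and r :: real
  show "0 \<le> inner x x"
    by (simp add: inner_quat_def)
  show "inner x x = 0 \<longleftrightarrow> x = 0"
    by (auto simp: inner_quat_def quat_eq_iff add_nonneg_eq_0_iff)
qed (simp_all add: inner_quat_def norm_quat_def dist_quat_def sgn_quat_def
      uniformity_quat_def open_quat_def algebra_simps)

end

instantiation quat :: euclidean_space
begin

definition "Basis = {Quat 1 0 0 0, Quat 0 1 0 0, Quat 0 0 1 0, Quat 0 0 0 1}"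

instance
proof
  fix u v x :: quat
  show "(Basis :: quat set) \<noteq> {}" "finite (Basis :: quat set)"
    by (simp_all add: Basis_quat_def)
  show "u \<in> Basis \<Longrightarrow> v \<in> Basis \<Longrightarrow> inner u v = (if u = v then 1 else 0)"
    unfolding Basis_quat_def inner_quat_def by (elim insertE emptyE) simp_all
  show "(\<forall>u\<in>Basis. inner x u = 0) \<longleftrightarrow> x = 0"
    by (simp add: Basis_quat_def inner_quat_def quat_eq_iff [of x 0])
qed

end

definition qcnj :: "quat \<Rightarrow> quat" where
  "qcnj q = Quat (qre q) (- qim1 q) (- qim2 q) (- qim3 q)"

lemma qcnj_sel [simp]:
  "qre (qcnj q) = qre q" "qim1 (qcnj q) = - qim1 q"
  "qim2 (qcnj q) = - qim2 q" "qim3 (qcnj q) = - qim3 q"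
  by (simp_all add: qcnj_def)

lemma norm_quat_square:
  "(norm q)\<^sup>2 = (qre q)\<^sup>2 + (qim1 q)\<^sup>2 + (qim2 q)\<^sup>2 + (qim3 q)\<^sup>2"
  by (simp add: norm_eq_sqrt_inner inner_quat_def power2_eq_square)

lemma qcnj_mult_self: "qcnj q * q = (norm q)\<^sup>2 *\<^sub>R 1" "q * qcnj q = (norm q)\<^sup>2 *\<^sub>R 1"
  unfolding quat_eq_iff by (simp_all add: norm_quat_square) (simp_all add: power2_eq_square)

instantiation quat :: real_normed_div_algebra
begin

definition "inverse q = qcnj q /\<^sub>R (norm q)\<^sup>2"
definition "x div y = x * inverse (y :: quat)"

instance
proof
  fix x y :: quat
  show "norm (x * y) = norm x * norm y"
  proof (rule power2_eq_imp_eq)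
    show "(norm (x * y))\<^sup>2 = (norm x * norm y)\<^sup>2"
      unfolding power_mult_distrib norm_quat_square quat_algebra_sel
      by (simp add: power2_eq_square algebra_simps)
  qed simp_all
  show "x \<noteq> 0 \<Longrightarrow> inverse x * x = 1" "x \<noteq> 0 \<Longrightarrow> x * inverse x = 1"
    by (simp_all add: inverse_quat_def qcnj_mult_self)
  show "x div y = x * inverse y"
    by (simp only: divide_quat_def)
  show "inverse (0 :: quat) = 0"
    by (simp add: inverse_quat_def)
qed

end

definition quat_sphere :: "quat set" where
  "quat_sphere = {q. q\<^sup>2 = - 1}"

text \<open>
  Elements of the Lebesgue spaces are represented by functions, not by classes modulo equality
  almost everywhere; the integrals below do not depend on the representative.
\<close>

definition L1_quat :: "(real \<Rightarrow> quat) set" where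
  "L1_quat = {f. integrable lebesgue f}"

definition L2_quat :: "(real \<Rightarrow> quat) set" where
  "L2_quat = {f \<in> borel_measurable lebesgue. integrable lebesgue (\<lambda>t. (norm (f t))\<^sup>2)}"

definition L2_quat_inner :: "(real \<Rightarrow> quat) \<Rightarrow> (real \<Rightarrow> quat) \<Rightarrow> quat" where
  "L2_quat_inner f g = (LINT t|lebesgue. qcnj (g t) * f t)"

definition L2_quat_norm :: "(real \<Rightarrow> quat) \<Rightarrow> real" where
  "L2_quat_norm f = sqrt (LINT t|lebesgue. (norm (f t))\<^sup>2)"

definition L2_quat_continuous :: "((real \<Rightarrow> quat) \<Rightarrow> (real \<Rightarrow> quat)) \<Rightarrow> bool" where
  "L2_quat_continuous T \<longleftrightarrow>
    (\<forall>f\<in>L2_quat. \<forall>\<epsilon>>0. \<exists>\<delta>>0. \<forall>g\<in>L2_quat.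
      L2_quat_norm (\<lambda>t. g t - f t) < \<delta> \<longrightarrow> L2_quat_norm (\<lambda>t. T g t - T f t) < \<epsilon>)"

definition qft_L1 :: "quat \<Rightarrow> (real \<Rightarrow> quat) \<Rightarrow> real \<Rightarrow> quat" where
  "qft_L1 I f \<omega> = (LINT t|lebesgue. exp ((- 2 * pi * \<omega> * t) *\<^sub>R I) * f t)"

definition is_qft_extension ::
    "quat \<Rightarrow> ((real \<Rightarrow> quat) \<Rightarrow> (real \<Rightarrow> quat)) \<Rightarrow> bool" where
  "is_qft_extension I T \<longleftrightarrow>
    (\<forall>f\<in>L2_quat. T f \<in> L2_quat) \<and> L2_quat_continuous T \<and>
    (\<forall>f\<in>L1_quat \<inter> L2_quat. T f = qft_L1 I f)"

text \<open>
  \<open>SOME\<close> rather than \<open>THE\<close>: the extension is unique only up to the choice of representatives,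
  that is, up to equality almost everywhere of its values outside \<open>L1_quat\<close>.
\<close>

definition qft :: "quat \<Rightarrow> (real \<Rightarrow> quat) \<Rightarrow> (real \<Rightarrow> quat)" where
  "qft I = (SOME T. is_qft_extension I T)"

end

(*
Only the L1 isometry needs analysis. Write F f = C - I S with the cosine and sine transforms C, S
of f. Since C is even, S is odd and |I| = 1, the parallelogram law turns the integral of |F f|^2
into the integral of |C|^2 + |S|^2, so no quaternion algebra is left. Damping this energy by
exp(-(\<epsilon> w)^2 / 2) and using Fubini gives the average of the autocorrelation of f against a Gaussian of
width \<epsilon> / (2 pi); the autocorrelation is continuous at 0, with value the squared norm of f there,
because translation is continuous in L1. Let \<epsilon> tend to 0.

By density and completeness of L2 a continuous extension exists, and every such extension T satisfies
|T f - (T g) e| = |f - g e| for each quaternion e, because F commutes with right multiplication.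
Polarization of this identity yields the component of the quaternionic inner product along e.
*)
theory Submission
  imports Defs "HOL-Probability.Characteristic_Functions"
begin

section \<open>Continuity of translation and the Gaussian\<close>

text \<open>Preservation of the norm alone would yield, by polarization, only the real part of the
  inner product. The factor \<open>e\<close> recovers the other components, and it has to stand on
  the right: left multiplication by a quaternion need not commute with \<open>I\<close>, while right
  multiplication passes through the kernel, and
  \<open>inner (qcnj g * f) e = inner f (g * e)\<close> puts \<open>e\<close> on just that side.
  Damping is needed because the energy in frequency is not known to be integrable in advance. The
  Gaussian makes Fubini applicable, and its removal by monotone convergence gives integrability
  together with the value. Continuity of translation in L1 does not control the autocorrelation
  where \<open>f\<close> is large, so a truncation of \<open>f\<close> enters there. Lebesgue
  measurable functions are replaced by Borel representatives before any product measure appears. An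
  extension to L2 is handled only through L2 norms, which do not see null sets.\<close>

lemma lborel_inner_compact:
  fixes A :: "'a::euclidean_space set"
  assumes A [measurable]: "A \<in> sets borel" and fin: "emeasure lborel A < \<infinity>" and "d > 0"
  obtains K where "compact K" "K \<subseteq> A" "emeasure lborel (A - K) < ennreal d"
proof -
  obtain T where T: "closed T" "T \<subseteq> A" "emeasure lebesgue (A - T) < ennreal (d / 2)"
  proof (rule sets_lebesgue_inner_closed)
    show "A \<in> sets lebesgue" using A by simp
    show "0 < d / 2" using \<open>d > 0\<close> by simp
  qed
  have T': "T \<in> sets borel" using T(1) by (rule borel_closed)
  \<comment> \<open>The part of \<open>A\<close> outside large balls shrinks to nothing; finite
    measure of \<open>A\<close> makes continuity from above available.\<close>
  have "(\<lambda>n. emeasure lborel (A - cball 0 (real n))) \<longlonglongrightarrow> emeasure lborel (\<Inter>n. A - cball 0 (real n))"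
  proof (rule Lim_emeasure_decseq)
    show "decseq (\<lambda>n. A - cball 0 (real n))"
      by (auto simp: decseq_def)
    have "emeasure lborel (A - cball 0 (real n)) \<le> emeasure lborel A" for n
      by (rule emeasure_mono) auto
    then show "emeasure lborel (A - cball 0 (real n)) \<noteq> \<infinity>" for n
      using fin by (metis infinity_ennreal_def leD top.not_eq_extremum)
  qed auto
  also have "(\<Inter>n. A - cball 0 (real n)) = {}"
  proof -
    have "\<exists>n. norm x \<le> real n" for x :: 'a
      by (rule real_arch_simple)
    then show ?thesis by (auto simp: set_eq_iff)
  qed
  finally have "eventually (\<lambda>n. emeasure lborel (A - cball 0 (real n)) < ennreal (d / 2)) sequentially"
    using \<open>d > 0\<close> by (intro order_tendstoD) auto
  then obtain n where n: "emeasure lborel (A - cball 0 (real n)) < ennreal (d / 2)"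
    by (auto dest: eventually_happens)
  show thesis
  proof
    show "compact (T \<inter> cball 0 (real n))" "T \<inter> cball 0 (real n) \<subseteq> A"
      using T by (auto simp: closed_Int_compact)
    have "emeasure lborel (A - T \<inter> cball 0 (real n)) \<le>
        emeasure lborel (A - T) + emeasure lborel (A - cball 0 (real n))"
      using T' by (subst Diff_Int) (intro emeasure_subadditive; simp)
    also have "\<dots> < ennreal (d / 2) + ennreal (d / 2)"
      using T(3) T' n by (intro add_strict_mono) simp_all
    finally show "emeasure lborel (A - T \<inter> cball 0 (real n)) < ennreal d"
      using \<open>d > 0\<close> by (simp flip: ennreal_plus)
  qed
qed

text \<open>Density argument: indicators, then sums, then dominated limits. For an indicator,
  \<open>A\<close> lies between a compact \<open>K\<close> and an open \<open>U\<close> of nearly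
  equal measure. A shift too small to carry a point of \<open>K\<close> out of \<open>U\<close>
  changes membership in \<open>A\<close> only for points that lie in \<open>U - K\<close> before or
  after the shift.\<close>

lemma tendsto_L1_translation:
  fixes f :: "real \<Rightarrow> 'a::{banach, second_countable_topology}" and u :: "'b \<Rightarrow> real"
  assumes "integrable lborel f" and u: "(u \<longlongrightarrow> 0) F"
  shows "((\<lambda>n. LINT s|lborel. norm (f (u n + s) - f s)) \<longlongrightarrow> 0) F"
  using assms(1)
proof (induction rule: integrable_induct)
  case (base A c)
  show ?case
  proof (rule tendstoI)
    fix e :: real assume "0 < e"
    \<comment> \<open>Adding 1 keeps \<open>q\<close> positive when \<open>c = 0\<close> and gives
      \<open>norm c / q < 1\<close>, hence a strict bound at the end. The 4 in \<open>d\<close> is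
      the 2 of \<open>emD\<close> times the two indicators of \<open>D\<close> in
      \<open>bound\<close>.\<close>
    define q where "q = norm c + 1"
    have "q > 0" "norm c < q"
      by (simp_all add: q_def add_nonneg_pos)
    define d where "d = e / 4 / q"
    have "d > 0"
      using \<open>0 < e\<close> \<open>q > 0\<close> by (simp add: d_def)
    have Ab [measurable]: "A \<in> sets borel" using base by simp
    obtain U where U: "open U" "A \<subseteq> U" "emeasure lborel (U - A) < ennreal d"
      using outer_regular_lborel[OF Ab \<open>d > 0\<close>] by metis
    obtain K where K: "compact K" "K \<subseteq> A" "emeasure lborel (A - K) < ennreal d"
      using lborel_inner_compact[OF Ab _ \<open>d > 0\<close>] base by auto
    have "K \<subseteq> U" using U K by auto
    obtain r where r: "r > 0" "(\<Union>x\<in>K. ball x r) \<subseteq> U"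
      using compact_subset_open_imp_ball_epsilon_subset[OF K(1) U(1) \<open>K \<subseteq> U\<close>] by metis
    define D where "D = U - K"
    have [measurable]: "D \<in> sets borel"
      unfolding D_def using U(1) K(1) by (intro sets.Diff borel_open borel_compact)
    have emD: "emeasure lborel D < ennreal (2 * d)"
    proof -
      have "D = (U - A) \<union> (A - K)" using U(2) K(2) by (auto simp: D_def)
      then have "emeasure lborel D \<le> emeasure lborel (U - A) + emeasure lborel (A - K)"
        using U(1) borel_compact[OF K(1)] by (simp add: emeasure_subadditive)
      also have "\<dots> < ennreal d + ennreal d"
        by (rule add_strict_mono[OF U(3) K(3)])
      finally show ?thesis using \<open>d > 0\<close> by (simp flip: ennreal_plus)
    qed
    then have iD: "integrable lborel (indicator D :: real \<Rightarrow> real)"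
      by (intro integrable_real_indicator) (auto intro: less_trans)
    have mD: "measure lborel D < 2 * d"
      using emD \<open>d > 0\<close> unfolding measure_def
      by (cases "emeasure lborel D" rule: ennreal_cases) (auto simp: ennreal_less_iff)
    have bound: "norm (indicator A (v + s) *\<^sub>R c - indicator A s *\<^sub>R c)
        \<le> norm c * (indicator D (v + s) + indicator D s)" if v: "\<bar>v\<bar> < r" for v s
    proof -
      have 1: "v + s \<in> U" if "s \<in> K"
        using that r(2) v by (force simp: dist_real_def)
      have 2: "s \<in> U" if "v + s \<in> K"
        using that r(2) v by (force simp: dist_real_def)
      show ?thesis
        using 1 2 K(2) U(2) unfolding D_def by (auto simp: indicator_def)
    qed
    have int_lt: "(LINT s|lborel. norm (indicator A (v + s) *\<^sub>R c - indicator A s *\<^sub>R c)) < e"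
      if v: "\<bar>v\<bar> < r" for v
    proof -
      have iDv: "integrable lborel (\<lambda>s. indicator D (v + s) :: real)"
        using lborel_integrable_real_affine[OF iD, of 1 v] by simp
      have "(LINT s|lborel. norm (indicator A (v + s) *\<^sub>R c - indicator A s *\<^sub>R c))
        \<le> (LINT s|lborel. norm c * (indicator D (v + s) + indicator D s))"
      proof (rule integral_mono_AE')
        show "integrable lborel (\<lambda>s. norm c * (indicator D (v + s) + indicator D s))"
          using iD iDv by simp
      qed (use bound[OF v] in auto)
      also have "\<dots> = norm c * (2 * measure lborel D)"
      proof -
        have "(LINT s|lborel. indicator D (v + s) :: real) = measure lborel D"
          using lborel_integral_real_affine[of 1 "indicator D :: real \<Rightarrow> real" v] by simp
        then show ?thesis using iD iDv by simp
      qed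
      also have "\<dots> \<le> norm c * (2 * (2 * d))"
        using mD by (intro mult_left_mono) auto
      also have "\<dots> = e * (norm c / q)"
        by (simp add: d_def)
      also have "\<dots> < e * 1"
        using \<open>0 < e\<close> \<open>q > 0\<close> \<open>norm c < q\<close> by (intro mult_strict_left_mono) auto
      finally show ?thesis by simp
    qed
    have "eventually (\<lambda>n. \<bar>u n\<bar> < r) F"
      using tendstoD[OF u r(1)] by simp
    then show "eventually (\<lambda>n. dist (LINT s|lborel. norm (indicator A (u n + s) *\<^sub>R c - indicator A s *\<^sub>R c)) 0 < e) F"
      by eventually_elim (use int_lt in \<open>auto simp: abs_of_nonneg\<close>)
  qed
next
  case (add f g)
  have tr: "integrable lborel (\<lambda>s. h (v + s))" if "integrable lborel h" for h :: "real \<Rightarrow> 'a" and v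
    using lborel_integrable_real_affine[OF that, of 1 v] by simp
  show ?case
  proof (rule Lim_null_comparison)
    show "((\<lambda>n. (LINT s|lborel. norm (f (u n + s) - f s)) + (LINT s|lborel. norm (g (u n + s) - g s))) \<longlongrightarrow> 0) F"
      using tendsto_add[OF add(3,4)] by simp
    show "\<forall>\<^sub>F n in F. norm (LINT s|lborel. norm (f (u n + s) + g (u n + s) - (f s + g s)))
        \<le> (LINT s|lborel. norm (f (u n + s) - f s)) + (LINT s|lborel. norm (g (u n + s) - g s))"
    proof (intro always_eventually allI)
      fix n
      have "(LINT s|lborel. norm (f (u n + s) + g (u n + s) - (f s + g s)))
        \<le> (LINT s|lborel. norm (f (u n + s) - f s) + norm (g (u n + s) - g s))"
        using add tr by (intro integral_mono integrable_norm Bochner_Integration.integrable_diff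
          Bochner_Integration.integrable_add norm_diff_triangle_ineq) auto
      then show "norm (LINT s|lborel. norm (f (u n + s) + g (u n + s) - (f s + g s)))
        \<le> (LINT s|lborel. norm (f (u n + s) - f s)) + (LINT s|lborel. norm (g (u n + s) - g s))"
        using add tr by simp
    qed
  qed
next
  case (lim f s)
  have tr: "integrable lborel (\<lambda>s. h (v + s))" if "integrable lborel h" for h :: "real \<Rightarrow> 'a" and v
    using lborel_integrable_real_affine[OF that, of 1 v] by simp
  have conv: "(\<lambda>i. LINT x|lborel. norm (s i x - f x)) \<longlonglongrightarrow> 0"
  proof -
    have "(\<lambda>i. LINT x|lborel. norm (s i x - f x)) \<longlonglongrightarrow> (LINT x|(lborel::real measure). 0)"
    proof (rule integral_dominated_convergence[where w="\<lambda>x. 3 * norm (f x)"])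
      show "AE x in lborel. (\<lambda>i. norm (s i x - f x)) \<longlonglongrightarrow> 0"
        using lim(2) by (intro AE_I2 tendsto_norm_zero LIM_zero) simp
      show "AE x in lborel. norm (norm (s i x - f x)) \<le> 3 * norm (f x)" for i
      proof (rule AE_I2)
        fix x show "norm (norm (s i x - f x)) \<le> 3 * norm (f x)"
          using lim(3)[of x i] norm_triangle_ineq4[of "s i x" "f x"] by simp
      qed
    qed (use lim in auto)
    then show ?thesis by simp
  qed
  show ?case
  proof (rule tendstoI)
    fix e :: real assume "0 < e"
    obtain i where i: "(LINT x|lborel. norm (s i x - f x)) < e / 3"
      using order_tendstoD(2)[OF conv, of "e / 3"] \<open>0 < e\<close> by (auto dest: eventually_happens)
    have "eventually (\<lambda>n. (LINT x|lborel. norm (s i (u n + x) - s i x)) < e / 3) F"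
      using order_tendstoD(2)[OF lim.IH[of i], of "e / 3"] \<open>0 < e\<close> by auto
    then show "eventually (\<lambda>n. dist (LINT x|lborel. norm (f (u n + x) - f x)) 0 < e) F"
    proof eventually_elim
      case (elim n)
      have si: "integrable lborel (\<lambda>x. s i x - f x)" using lim by simp
      \<comment> \<open>Three-term estimate through the approximant \<open>s i\<close>. By
        translation invariance the shifted error equals the unshifted one, hence the factor 2
        below.\<close>
      have "(LINT x|lborel. norm (f (u n + x) - f x)) \<le>
        (LINT x|lborel. norm (s i (u n + x) - f (u n + x)) + norm (s i (u n + x) - s i x) + norm (s i x - f x))"
      proof (rule integral_mono)
        fix x
        have "f (u n + x) - f x = - (s i (u n + x) - f (u n + x)) + (s i (u n + x) - s i x) + (s i x - f x)"
          by simp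
        then show "norm (f (u n + x) - f x) \<le>
            norm (s i (u n + x) - f (u n + x)) + norm (s i (u n + x) - s i x) + norm (s i x - f x)"
          by (metis norm_minus_cancel norm_triangle_le norm_triangle_ineq add_mono order_refl)
      qed (use lim tr tr[OF si] in auto)
      also have "\<dots> = 2 * (LINT x|lborel. norm (s i x - f x)) + (LINT x|lborel. norm (s i (u n + x) - s i x))"
        using lim tr tr[OF si] lborel_integral_real_affine[of 1 "\<lambda>x. norm (s i x - f x)" "u n"] by simp
      also have "\<dots> < e" using i elim by simp
      finally show ?case by (simp add: abs_of_nonneg)
    qed
  qed
qed

section \<open>Cosine integrals of Gaussians\<close>

lemma integral_std_normal_cos:
  "(LINT x|lborel. std_normal_density x * cos (t * x)) = exp (- t\<^sup>2 / 2)"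
proof -
  have "char std_normal_distribution t = (LINT x|lborel. std_normal_density x *\<^sub>R iexp (t * x))"
    unfolding char_def by (subst integral_density) auto
  moreover have "integrable lborel (\<lambda>x. std_normal_density x *\<^sub>R iexp (t * x))"
    by (rule Bochner_Integration.integrable_bound[where f=std_normal_density]) auto
  ultimately have "Re (char std_normal_distribution t) = (LINT x|lborel. std_normal_density x * cos (t * x))"
    by (simp flip: integral_Re add: Re_exp)
  then show ?thesis
    by (simp add: char_std_normal_distribution)
qed

text \<open>Rescaling by \<open>\<epsilon>\<close> reduces this to the characteristic function of
  the standard normal law. With the factor \<open>2 * pi\<close> in the frequency the result is
  exactly a probability density, so no constant survives in the Plancherel identity.\<close>

lemma integral_gaussian_cos:
  assumes "\<epsilon> > 0"
  shows "(LINT w|lborel. exp (- (\<epsilon> * w)\<^sup>2 / 2) * cos (2 * pi * w * x)) = normal_density 0 (\<epsilon> / (2 * pi)) x"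
proof -
  have "(LINT w|lborel. exp (- (\<epsilon> * w)\<^sup>2 / 2) * cos (2 * pi * w * x))
    = (1 / \<epsilon>) * (LINT w|lborel. exp (- w\<^sup>2 / 2) * cos (2 * pi * x / \<epsilon> * w))"
    using assms by (subst lborel_integral_real_affine[of "1/\<epsilon>" _ 0]) (auto simp: field_simps)
  also have "(LINT w|lborel. exp (- w\<^sup>2 / 2) * cos (2 * pi * x / \<epsilon> * w))
    = sqrt (2 * pi) * (LINT w|lborel. std_normal_density w * cos (2 * pi * x / \<epsilon> * w))"
    unfolding integral_mult_right_zero[symmetric] std_normal_density_def by (simp add: mult.assoc)
  also have "\<dots> = sqrt (2 * pi) * exp (- (2 * pi * x / \<epsilon>)\<^sup>2 / 2)"
    by (subst integral_std_normal_cos) simp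
  also have "(1 / \<epsilon>) * \<dots> = normal_density 0 (\<epsilon> / (2 * pi)) x"
    using assms by (simp add: normal_density_def power_divide real_sqrt_divide real_sqrt_mult field_simps power2_eq_square)
  finally show ?thesis .
qed

section \<open>Plancherel identity for the cosine and sine transforms\<close>

lemma lborel_integrable_translation:
  fixes f :: "real \<Rightarrow> 'a::{banach, second_countable_topology}"
  assumes "integrable lborel f"
  shows "integrable lborel (\<lambda>s. f (v + s))"
  using lborel_integrable_real_affine[OF assms, of 1 v] by simp

lemma lborel_integral_translation:
  fixes f :: "real \<Rightarrow> 'a::{banach, second_countable_topology}"
  shows "(LINT s|lborel. f (v + s)) = (LINT s|lborel. f s)"
  using lborel_integral_real_affine[of 1 f v] by simp

lemma abs_inner_le_half_squares:
  fixes x y :: "'a::real_inner"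
  shows "\<bar>inner x y\<bar> \<le> ((norm x)\<^sup>2 + (norm y)\<^sup>2) / 2"
proof -
  have "\<bar>inner x y\<bar> \<le> norm x * norm y" by (rule Cauchy_Schwarz_ineq2)
  also have "\<dots> \<le> ((norm x)\<^sup>2 + (norm y)\<^sup>2) / 2"
    using sum_squares_bound[of "norm x" "norm y"] by simp
  finally show ?thesis .
qed

text \<open>Real kernels act by scalar multiplication, so both transforms make sense for values in
  any separable Banach space and the analysis never meets the quaternion product.\<close>

definition cosine_transform :: "(real \<Rightarrow> 'a::{banach, second_countable_topology}) \<Rightarrow> real \<Rightarrow> 'a" where
  "cosine_transform f w = (LINT t|lborel. cos (2 * pi * w * t) *\<^sub>R f t)"

definition sine_transform :: "(real \<Rightarrow> 'a::{banach, second_countable_topology}) \<Rightarrow> real \<Rightarrow> 'a" where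
  "sine_transform f w = (LINT t|lborel. sin (2 * pi * w * t) *\<^sub>R f t)"

definition autocorrelation :: "(real \<Rightarrow> 'a::{banach, second_countable_topology, real_inner}) \<Rightarrow> real \<Rightarrow> real" where
  "autocorrelation f u = (LINT s|lborel. inner (f s) (f (u + s)))"

lemma integrable_cos_sin:
  fixes f :: "real \<Rightarrow> 'a::{banach, second_countable_topology}"
  assumes "integrable lborel f"
  shows "integrable lborel (\<lambda>t. cos (a * t) *\<^sub>R f t)" "integrable lborel (\<lambda>t. sin (a * t) *\<^sub>R f t)"
proof -
  have [measurable]: "f \<in> borel_measurable borel" using assms by simp
  have cs: "\<bar>cos (a * t)\<bar> * norm (f t) \<le> norm (f t)" "\<bar>sin (a * t)\<bar> * norm (f t) \<le> norm (f t)" for t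
    by (auto intro!: mult_left_le_one_le)
  show "integrable lborel (\<lambda>t. cos (a * t) *\<^sub>R f t)"
    by (rule Bochner_Integration.integrable_bound[OF assms]) (auto simp: cs)
  show "integrable lborel (\<lambda>t. sin (a * t) *\<^sub>R f t)"
    by (rule Bochner_Integration.integrable_bound[OF assms]) (auto simp: cs)
qed

text \<open>Serves as the source of Borel measurability in the frequency variable.\<close>

lemma continuous_cosine_transform:
  fixes f :: "real \<Rightarrow> 'a::{banach, second_countable_topology}"
  assumes "integrable lborel f"
  shows "continuous_on UNIV (cosine_transform f)"
proof (rule continuous_at_imp_continuous_on, rule ballI)
  have [measurable]: "f \<in> borel_measurable borel" using assms by simp
  fix w :: real
  show "isCont (cosine_transform f) w"
    unfolding isCont_def
  proof (rule tendsto_at_iff_sequentially[THEN iffD2])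
    show "\<forall>X. (\<forall>i. X i \<in> UNIV - {w}) \<longrightarrow> X \<longlonglongrightarrow> w \<longrightarrow> (cosine_transform f \<circ> X) \<longlonglongrightarrow> cosine_transform f w"
    proof (intro allI impI)
      fix X :: "nat \<Rightarrow> real" assume "X \<longlonglongrightarrow> w"
      then show "(cosine_transform f \<circ> X) \<longlonglongrightarrow> cosine_transform f w"
        unfolding comp_def cosine_transform_def
        by (intro integral_dominated_convergence[where w="\<lambda>t. norm (f t)"])
          (auto intro!: tendsto_intros mult_left_le_one_le assms integrable_norm)
    qed
  qed
qed

lemma continuous_sine_transform:
  fixes f :: "real \<Rightarrow> 'a::{banach, second_countable_topology}"
  assumes "integrable lborel f"
  shows "continuous_on UNIV (sine_transform f)"
proof (rule continuous_at_imp_continuous_on, rule ballI)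
  have [measurable]: "f \<in> borel_measurable borel" using assms by simp
  fix w :: real
  show "isCont (sine_transform f) w"
    unfolding isCont_def
  proof (rule tendsto_at_iff_sequentially[THEN iffD2])
    show "\<forall>X. (\<forall>i. X i \<in> UNIV - {w}) \<longrightarrow> X \<longlonglongrightarrow> w \<longrightarrow> (sine_transform f \<circ> X) \<longlonglongrightarrow> sine_transform f w"
    proof (intro allI impI)
      fix X :: "nat \<Rightarrow> real" assume "X \<longlonglongrightarrow> w"
      then show "(sine_transform f \<circ> X) \<longlonglongrightarrow> sine_transform f w"
        unfolding comp_def sine_transform_def
        by (intro integral_dominated_convergence[where w="\<lambda>t. norm (f t)"])
          (auto intro!: tendsto_intros mult_left_le_one_le assms integrable_norm)
    qed
  qed
qed

text \<open>Over \<open>lborel\<close> the function \<open>f\<close> is Borel, so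
  \<open>f (u + s)\<close> is jointly measurable for the product measures to which Fubini is
  applied.\<close>

locale L1_L2_function =
  fixes f :: "real \<Rightarrow> 'a::euclidean_space"
  assumes f_int: "integrable lborel f"
    and f_sq: "integrable lborel (\<lambda>t. (norm (f t))\<^sup>2)"
begin

lemma f_measurable [measurable]: "f \<in> borel_measurable borel"
  using f_int by simp

lemma integrable_inner_translation: "integrable lborel (\<lambda>s. inner (f s) (f (u + s)))"
proof (rule Bochner_Integration.integrable_bound)
  show "integrable lborel (\<lambda>s. ((norm (f s))\<^sup>2 + (norm (f (u + s)))\<^sup>2) / 2)"
    using f_sq lborel_integrable_translation[OF f_sq] by simp
  show "AE s in lborel. norm (inner (f s) (f (u + s))) \<le> norm (((norm (f s))\<^sup>2 + (norm (f (u + s)))\<^sup>2) / 2)"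
    by (intro AE_I2) (metis abs_inner_le_half_squares abs_ge_self order_trans real_norm_def)
qed measurable

text \<open>The bound is uniform in \<open>u\<close>: it justifies Fubini against the Gaussian
  weight and dominates the autocorrelation when the width shrinks.\<close>

lemma integral_abs_inner_translation_le:
  "(LINT s|lborel. \<bar>inner (f s) (f (u + s))\<bar>) \<le> (LINT t|lborel. (norm (f t))\<^sup>2)"
proof -
  have "(LINT s|lborel. \<bar>inner (f s) (f (u + s))\<bar>) \<le> (LINT s|lborel. ((norm (f s))\<^sup>2 + (norm (f (u + s)))\<^sup>2) / 2)"
    using f_sq lborel_integrable_translation[OF f_sq] integrable_inner_translation
    by (intro integral_mono abs_inner_le_half_squares) auto
  also have "\<dots> = (LINT t|lborel. (norm (f t))\<^sup>2)"
    using f_sq lborel_integrable_translation[OF f_sq]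
      lborel_integral_translation[of "\<lambda>t. (norm (f t))\<^sup>2" u] by simp
  finally show ?thesis .
qed

lemma autocorrelation_bounded: "\<bar>autocorrelation f u\<bar> \<le> (LINT t|lborel. (norm (f t))\<^sup>2)"
  unfolding autocorrelation_def
  using integral_abs_bound integral_abs_inner_translation_le by (rule order_trans)

lemma autocorrelation_measurable [measurable]: "autocorrelation f \<in> borel_measurable borel"
  unfolding autocorrelation_def by measurable

text \<open>Cauchy-Schwarz dominates the integrand by a product of functions of one variable each,
  integrable because \<open>f\<close> is in L1.\<close>

lemma integrable_inner_product:
  "integrable (lborel \<Otimes>\<^sub>M lborel) (\<lambda>(s, t). inner (f s) (f t))"
proof (rule Bochner_Integration.integrable_bound)
  show "integrable (lborel \<Otimes>\<^sub>M lborel) (\<lambda>(s, t). norm (f s) * norm (f t))"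
    using f_int by (intro lborel_pair.Fubini_integrable) (auto simp: case_prod_beta')
qed (auto simp: Cauchy_Schwarz_ineq2)

text \<open>With \<open>u = t - s\<close> the Gaussian depends on \<open>u\<close> alone, and the
  integral over \<open>s\<close> is the autocorrelation. Rescaling then moves
  \<open>\<sigma>\<close> from the weight into the argument, so that a single fixed density remains
  and small \<open>\<sigma>\<close> can be treated by dominated convergence.\<close>

lemma integral_gaussian_autocorrelation:
  assumes "\<sigma> > 0"
  shows "(LINT s|lborel. LINT t|lborel. normal_density 0 \<sigma> (t - s) * inner (f s) (f t)) =
    (LINT u|lborel. std_normal_density u * autocorrelation f (\<sigma> * u))"
proof -
  have "(LINT s|lborel. LINT t|lborel. normal_density 0 \<sigma> (t - s) * inner (f s) (f t)) =
    (LINT s|lborel. LINT u|lborel. normal_density 0 \<sigma> u * inner (f s) (f (u + s)))"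
  proof (rule Bochner_Integration.integral_cong[OF refl])
    show "(LINT t|lborel. normal_density 0 \<sigma> (t - s) * inner (f s) (f t)) =
        (LINT u|lborel. normal_density 0 \<sigma> u * inner (f s) (f (u + s)))" for s
      by (subst lborel_integral_translation[where v=s, symmetric]) (simp add: add.commute)
  qed
  also have "\<dots> = (LINT u|lborel. LINT s|lborel. normal_density 0 \<sigma> u * inner (f s) (f (u + s)))"
  proof (rule lborel_pair.Fubini_integral)
    show "integrable (lborel \<Otimes>\<^sub>M lborel) (\<lambda>(u, s). normal_density 0 \<sigma> u * inner (f s) (f (u + s)))"
    proof (rule lborel_pair.Fubini_integrable)
      show "integrable lborel (\<lambda>u. LINT s|lborel. norm (case (u, s) of (u, s) \<Rightarrow> normal_density 0 \<sigma> u * inner (f s) (f (u + s))))"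
      proof (rule Bochner_Integration.integrable_bound)
        show "integrable lborel (\<lambda>u. normal_density 0 \<sigma> u * (LINT t|lborel. (norm (f t))\<^sup>2))"
          using assms by simp
        show "AE u in lborel. norm (LINT s|lborel. norm (case (u, s) of (u, s) \<Rightarrow> normal_density 0 \<sigma> u * inner (f s) (f (u + s))))
            \<le> norm (normal_density 0 \<sigma> u * (LINT t|lborel. (norm (f t))\<^sup>2))"
          using integral_abs_inner_translation_le
          by (auto simp: abs_mult intro!: mult_left_mono)
      qed measurable
      show "AE u in lborel. integrable lborel (\<lambda>s. case (u, s) of (u, s) \<Rightarrow> normal_density 0 \<sigma> u * inner (f s) (f (u + s)))"
        using integrable_inner_translation by simp
    qed measurable
  qed
  also have "\<dots> = (LINT u|lborel. normal_density 0 \<sigma> u * autocorrelation f u)"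
    unfolding autocorrelation_def by simp
  also have "\<dots> = (LINT u|lborel. std_normal_density u * autocorrelation f (\<sigma> * u))"
  proof -
    have "\<sigma> * normal_density 0 \<sigma> (\<sigma> * u) = std_normal_density u" for u
      using assms by (simp add: normal_density_def real_sqrt_mult power_mult_distrib)
    then have "\<sigma> * (normal_density 0 \<sigma> (\<sigma> * u) * c) = std_normal_density u * c" for u c
      by (metis mult.assoc)
    note scale = this
    have "(LINT u|lborel. normal_density 0 \<sigma> u * autocorrelation f u) =
        (LINT u|lborel. \<sigma> * (normal_density 0 \<sigma> (\<sigma> * u) * autocorrelation f (\<sigma> * u)))"
      using assms lborel_integral_real_affine[of \<sigma> "\<lambda>u. normal_density 0 \<sigma> u * autocorrelation f u" 0] by simp
    then show ?thesis
      unfolding scale .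
  qed
  finally show ?thesis .
qed

text \<open>The deviation from the limit is the integral of
  \<open>inner (f s) (f (u n + s) - f s)\<close>. Where \<open>norm (f s)\<close> is at most
  \<open>k\<close>, it is controlled by \<open>k\<close> times the L1 distance to the translate.
  Elsewhere a weighted arithmetic-geometric inequality puts a large weight on the tail of
  \<open>f\<close>, whose square integral is small, and a small weight on the increment, whose
  square integral is only bounded.\<close>

lemma tendsto_autocorrelation:
  assumes "u \<longlonglongrightarrow> 0"
  shows "(\<lambda>n. autocorrelation f (u n)) \<longlonglongrightarrow> (LINT t|lborel. (norm (f t))\<^sup>2)"
proof -
  define E where "E = (LINT t|lborel. (norm (f t))\<^sup>2)"
  have "E \<ge> 0" by (simp add: E_def)
  define r where "r k t = (if norm (f t) \<le> real k then 0 else f t)" for k :: nat and t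
  have r_le: "norm (r k t) \<le> norm (f t)" for k t by (simp add: r_def)
  have r_meas [measurable]: "r k \<in> borel_measurable borel" for k
    unfolding r_def by measurable
  have r_int: "integrable lborel (\<lambda>t. (norm (r k t))\<^sup>2)" for k
    by (rule Bochner_Integration.integrable_bound[OF f_sq]) (auto simp: r_le power_mono)
  have r_lim: "(\<lambda>k. LINT t|lborel. (norm (r k t))\<^sup>2) \<longlonglongrightarrow> 0"
  proof -
    have "(\<lambda>k. LINT t|lborel. (norm (r k t))\<^sup>2) \<longlonglongrightarrow> (LINT t|(lborel::real measure). 0)"
    proof (rule integral_dominated_convergence[where w="\<lambda>t. (norm (f t))\<^sup>2"])
      show "AE t in lborel. (\<lambda>k. (norm (r k t))\<^sup>2) \<longlonglongrightarrow> 0"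
      proof (rule AE_I2, rule tendsto_eventually)
        fix t
        obtain N where "norm (f t) \<le> real N" using real_arch_simple by blast
        then show "eventually (\<lambda>k. (norm (r k t))\<^sup>2 = 0) sequentially"
          unfolding eventually_sequentially r_def by (intro exI[of _ N]) auto
      qed
    qed (auto simp: f_sq r_le power_mono)
    then show ?thesis by simp
  qed
  show ?thesis
    unfolding E_def[symmetric]
  proof (rule LIM_zero_cancel, rule tendstoI)
    fix e :: real assume "e > 0"
    \<comment> \<open>\<open>\<eta>\<close> is fixed before \<open>k\<close>, and \<open>k\<close>
      before \<open>n\<close>. It keeps the increment term at \<open>2 * \<eta> * E < e / 2\<close>;
      the 1 in the denominator covers \<open>E = 0\<close>.\<close>
    define \<eta> where "\<eta> = e / 4 / (E + 1)"
    have \<eta>: "\<eta> > 0" using \<open>e > 0\<close> \<open>E \<ge> 0\<close> by (simp add: \<eta>_def)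
    have \<eta>E: "2 * \<eta> * E < e / 2"
    proof -
      have "E + 1 \<noteq> 0" using \<open>E \<ge> 0\<close> by simp
      then have "\<eta> * (E + 1) = e / 4"
        unfolding \<eta>_def by (rule nonzero_eq_divide_eq[THEN iffD1]) simp
      then show ?thesis using \<eta> by (simp add: algebra_simps)
    qed
    \<comment> \<open>The tail is later divided by \<open>2 * \<eta>\<close>, which leaves
      \<open>e / 4\<close>.\<close>
    obtain k where k: "(LINT t|lborel. (norm (r k t))\<^sup>2) < \<eta> * e / 2"
      using order_tendstoD(2)[OF r_lim, of "\<eta> * e / 2"] \<eta> \<open>e > 0\<close> by (auto dest: eventually_happens)
    have "(\<lambda>n. real k * (LINT s|lborel. norm (f (u n + s) - f s))) \<longlonglongrightarrow> real k * 0"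
      by (intro tendsto_mult_left tendsto_L1_translation f_int assms)
    then have "eventually (\<lambda>n. real k * (LINT s|lborel. norm (f (u n + s) - f s)) < e / 4) sequentially"
      using \<open>e > 0\<close> by (intro order_tendstoD(2)) auto
    then show "eventually (\<lambda>n. dist (autocorrelation f (u n) - E) 0 < e) sequentially"
    proof eventually_elim
      case (elim n)
      let ?d = "\<lambda>s. f (u n + s) - f s"
      note tr = lborel_integrable_translation[OF f_sq, of "u n"] lborel_integrable_translation[OF f_int, of "u n"]
      have bnd: "\<bar>inner (f s) (?d s)\<bar> \<le>
          real k * norm (?d s) + (norm (r k s))\<^sup>2 / (2 * \<eta>) + \<eta> * ((norm (f (u n + s)))\<^sup>2 + (norm (f s))\<^sup>2)" for s
      proof (cases "norm (f s) \<le> real k")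
        case True
        have "\<bar>inner (f s) (?d s)\<bar> \<le> norm (f s) * norm (?d s)" by (rule Cauchy_Schwarz_ineq2)
        also have "\<dots> \<le> real k * norm (?d s)" using True by (rule mult_right_mono) simp
        finally show ?thesis using True \<eta> by (simp add: r_def add_increasing2)
      next
        case False
        \<comment> \<open>Parallelogram law with the square of the sum discarded.\<close>
        have sq: "(norm (?d s))\<^sup>2 \<le> 2 * ((norm (f (u n + s)))\<^sup>2 + (norm (f s))\<^sup>2)"
          using zero_le_power2[of "norm (f (u n + s) + f s)"]
          by (simp add: power2_norm_eq_inner inner_simps inner_commute)
        have "\<bar>inner (f s) (?d s)\<bar> = \<bar>inner (f s /\<^sub>R sqrt \<eta>) (sqrt \<eta> *\<^sub>R ?d s)\<bar>"
          using \<eta> by (simp flip: mult.assoc)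
        also have "\<dots> \<le> ((norm (f s /\<^sub>R sqrt \<eta>))\<^sup>2 + (norm (sqrt \<eta> *\<^sub>R ?d s))\<^sup>2) / 2"
          by (rule abs_inner_le_half_squares)
        also have "\<dots> = (norm (f s))\<^sup>2 / (2 * \<eta>) + \<eta> * (norm (?d s))\<^sup>2 / 2"
        proof -
          have "(norm (x /\<^sub>R sqrt \<eta>))\<^sup>2 = (norm x)\<^sup>2 / \<eta>" "(norm (sqrt \<eta> *\<^sub>R x))\<^sup>2 = \<eta> * (norm x)\<^sup>2" for x :: 'a
            using \<eta> by (simp_all add: power_mult_distrib power_inverse divide_inverse mult.commute)
          then show ?thesis by (simp only: add_divide_distrib) simp
        qed
        also have "\<dots> \<le> (norm (f s))\<^sup>2 / (2 * \<eta>) + \<eta> * ((norm (f (u n + s)))\<^sup>2 + (norm (f s))\<^sup>2)"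
          using sq \<eta> by simp
        also have "\<dots> \<le> real k * norm (?d s) + (norm (f s))\<^sup>2 / (2 * \<eta>) + \<eta> * ((norm (f (u n + s)))\<^sup>2 + (norm (f s))\<^sup>2)"
          by simp
        finally show ?thesis unfolding r_def if_not_P[OF False] .
      qed
      have "autocorrelation f (u n) - E = (LINT s|lborel. inner (f s) (?d s))"
        using integrable_inner_translation[of "u n"] f_sq
        by (simp add: autocorrelation_def E_def inner_diff_right power2_norm_eq_inner)
      also have "\<bar>\<dots>\<bar> \<le> (LINT s|lborel. \<bar>inner (f s) (?d s)\<bar>)"
        by (rule integral_abs_bound)
      also have "\<dots> \<le> (LINT s|lborel. real k * norm (?d s) + (norm (r k s))\<^sup>2 / (2 * \<eta>) + \<eta> * ((norm (f (u n + s)))\<^sup>2 + (norm (f s))\<^sup>2))"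
      proof (rule integral_mono)
        show "integrable lborel (\<lambda>s. \<bar>inner (f s) (?d s)\<bar>)"
          using integrable_inner_translation[of "u n"] f_sq
          by (simp add: inner_diff_right power2_norm_eq_inner)
      qed (use bnd r_int f_sq f_int tr in simp_all)
      also have "\<dots> = real k * (LINT s|lborel. norm (?d s)) + (LINT s|lborel. (norm (r k s))\<^sup>2) / (2 * \<eta>) + 2 * \<eta> * E"
        using r_int f_sq f_int tr lborel_integral_translation[of "\<lambda>t. (norm (f t))\<^sup>2" "u n"]
        by (simp add: E_def)
      also have "\<dots> < e / 4 + e / 4 + e / 2"
      proof -
        have "(LINT s|lborel. (norm (r k s))\<^sup>2) / (2 * \<eta>) < e / 4"
          using k \<eta> by (simp add: field_simps)
        then show ?thesis using elim \<eta>E by linarith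
      qed
      finally show ?case by simp
    qed
  qed
qed

text \<open>Both squared norms expand into double integrals, and the addition theorem for the cosine
  merges them. The frequency then enters only through \<open>t - s\<close>, which is why the
  autocorrelation appears.\<close>

lemma cosine_sine_energy:
  "(norm (cosine_transform f w))\<^sup>2 + (norm (sine_transform f w))\<^sup>2 =
    (LINT s|lborel. LINT t|lborel. cos (2 * pi * w * (t - s)) * inner (f s) (f t))"
proof -
  let ?c = "\<lambda>t. cos (2 * pi * w * t) *\<^sub>R f t" and ?s = "\<lambda>t. sin (2 * pi * w * t) *\<^sub>R f t"
  note ci = integrable_cos_sin[OF f_int, of "2 * pi * w"]
  have "(norm (cosine_transform f w))\<^sup>2 + (norm (sine_transform f w))\<^sup>2 =
    (LINT s|lborel. inner (?c s) (cosine_transform f w)) + (LINT s|lborel. inner (?s s) (sine_transform f w))"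
    unfolding power2_norm_eq_inner using ci
    by (simp add: cosine_transform_def sine_transform_def del: inner_scaleR_left)
  also have "\<dots> = (LINT s|lborel. inner (?c s) (cosine_transform f w) + inner (?s s) (sine_transform f w))"
    using ci by (simp del: inner_scaleR_left)
  also have "\<dots> = (LINT s|lborel. LINT t|lborel. cos (2 * pi * w * (t - s)) * inner (f s) (f t))"
  proof (rule Bochner_Integration.integral_cong[OF refl])
    fix s
    have "inner (?c s) (cosine_transform f w) + inner (?s s) (sine_transform f w) =
      (LINT t|lborel. inner (?c s) (?c t)) + (LINT t|lborel. inner (?s s) (?s t))"
      unfolding cosine_transform_def sine_transform_def using ci
      by (simp del: inner_scaleR_left inner_scaleR_right)
    also have "\<dots> = (LINT t|lborel. inner (?c s) (?c t) + inner (?s s) (?s t))"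
      using ci by (simp del: inner_scaleR_left inner_scaleR_right)
    also have "\<dots> = (LINT t|lborel. cos (2 * pi * w * (t - s)) * inner (f s) (f t))"
      by (simp add: right_diff_distrib cos_diff algebra_simps)
    finally show "inner (?c s) (cosine_transform f w) + inner (?s s) (sine_transform f w) =
      (LINT t|lborel. cos (2 * pi * w * (t - s)) * inner (f s) (f t))" .
  qed
  finally show ?thesis .
qed

lemma integrable_gaussian: "\<epsilon> > 0 \<Longrightarrow> integrable lborel (\<lambda>w::real. exp (- (\<epsilon> * w)\<^sup>2 / 2))"
proof -
  assume "\<epsilon> > 0"
  have "integrable lborel (\<lambda>w. sqrt (2 * pi) * std_normal_density (0 + \<epsilon> * w))"
    using \<open>\<epsilon> > 0\<close> by (intro integrable_mult_right lborel_integrable_real_affine) auto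
  then show ?thesis by (simp add: std_normal_density_def)
qed

text \<open>The triple integrand is dominated by the Gaussian times
  \<open>\<bar>inner (f s) (f t)\<bar>\<close>, so the frequency may be integrated first, which
  produces \<open>normal_density\<close>. The pair of time variables is treated as one point
  \<open>p\<close> of the plane, so that Fubini for two factors suffices.\<close>

lemma integral_damped_energy:
  assumes "\<epsilon> > 0"
  shows "integrable lborel (\<lambda>w. exp (- (\<epsilon> * w)\<^sup>2 / 2) * ((norm (cosine_transform f w))\<^sup>2 + (norm (sine_transform f w))\<^sup>2))" (is ?int)
    and "(LINT w|lborel. exp (- (\<epsilon> * w)\<^sup>2 / 2) * ((norm (cosine_transform f w))\<^sup>2 + (norm (sine_transform f w))\<^sup>2)) =
      (LINT u|lborel. std_normal_density u * autocorrelation f (\<epsilon> / (2 * pi) * u))" (is ?eq)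
proof -
  let ?g = "\<lambda>w. exp (- (\<epsilon> * w)\<^sup>2 / 2)"
  let ?P = "lborel \<Otimes>\<^sub>M lborel :: (real \<times> real) measure"
  let ?h = "\<lambda>w p. ?g w * (cos (2 * pi * w * (snd p - fst p)) * inner (f (fst p)) (f (snd p)))"
  have ip: "integrable lborel (\<lambda>p. inner (f (fst p)) (f (snd p)))"
    using integrable_inner_product by (simp add: case_prod_beta' lborel_prod)
  have int: "integrable (lborel \<Otimes>\<^sub>M lborel) (case_prod ?h)"
  proof (rule Bochner_Integration.integrable_bound)
    show "integrable (lborel \<Otimes>\<^sub>M lborel) (\<lambda>(w::real, p::real \<times> real). ?g w * \<bar>inner (f (fst p)) (f (snd p))\<bar>)"
    proof (rule lborel_pair.Fubini_integrable)
      show "integrable lborel (\<lambda>w::real. LINT p|(lborel::(real \<times> real) measure). norm (case (w, p) of (w, p) \<Rightarrow> ?g w * \<bar>inner (f (fst p)) (f (snd p))\<bar>))"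
        using integrable_gaussian[OF assms] by simp
      show "AE w in lborel. integrable lborel (\<lambda>p. case (w, p) of (w, p) \<Rightarrow> ?g w * \<bar>inner (f (fst p)) (f (snd p))\<bar>)"
        using ip by simp
    qed (simp add: lborel_prod[symmetric])
    show "AE p in lborel \<Otimes>\<^sub>M lborel. norm (case_prod ?h p) \<le> norm (case p of (w, p) \<Rightarrow> ?g w * \<bar>inner (f (fst p)) (f (snd p))\<bar>)"
      by (auto simp: abs_mult intro!: AE_I2 mult_left_le_one_le)
  qed (simp add: lborel_prod[symmetric])
  have inner_eq: "(LINT p|lborel. ?h w p) = ?g w * ((norm (cosine_transform f w))\<^sup>2 + (norm (sine_transform f w))\<^sup>2)" for w
  proof -
    have "integrable (lborel \<Otimes>\<^sub>M lborel) (\<lambda>(s, t). cos (2 * pi * w * (t - s)) * inner (f s) (f t))"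
      by (rule Bochner_Integration.integrable_bound[OF integrable_inner_product])
        (auto simp: abs_mult case_prod_beta' intro!: AE_I2 mult_left_le_one_le)
    from lborel_pair.integral_fst[OF this] show ?thesis
      by (simp add: cosine_sine_energy lborel_prod case_prod_beta')
  qed
  show ?int
    using lborel_pair.integrable_fst[OF int] by (simp only: inner_eq)
  have "(LINT w|lborel. ?g w * ((norm (cosine_transform f w))\<^sup>2 + (norm (sine_transform f w))\<^sup>2)) =
      (LINT w|lborel. LINT p|lborel. ?h w p)"
    by (simp only: inner_eq)
  also have "\<dots> = (LINT p|lborel. LINT w|lborel. ?h w p)"
    by (rule lborel_pair.Fubini_integral[OF int, symmetric])
  also have "\<dots> = (LINT p|lborel. normal_density 0 (\<epsilon> / (2 * pi)) (snd p - fst p) * inner (f (fst p)) (f (snd p)))"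
    unfolding mult.assoc[symmetric] integral_mult_left_zero integral_gaussian_cos[OF assms] ..
  also have "\<dots> = (LINT s|lborel. LINT t|lborel. normal_density 0 (\<epsilon> / (2 * pi)) (t - s) * inner (f s) (f t))"
  proof -
    let ?k = "\<lambda>p. normal_density 0 (\<epsilon> / (2 * pi)) (snd p - fst p) * inner (f (fst p)) (f (snd p))"
    have "integrable lborel (\<lambda>p. LINT w|lborel. ?h w p)"
      by (rule lborel_pair.integrable_snd[OF int])
    then have "integrable lborel ?k"
      unfolding mult.assoc[symmetric] integral_mult_left_zero integral_gaussian_cos[OF assms] .
    then have "integrable (lborel \<Otimes>\<^sub>M lborel) (\<lambda>(s, t). normal_density 0 (\<epsilon> / (2 * pi)) (t - s) * inner (f s) (f t))"
      by (simp add: lborel_prod case_prod_beta')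
    from lborel_pair.integral_fst[OF this] show ?thesis
      by (simp add: lborel_prod case_prod_beta')
  qed
  also have "\<dots> = (LINT u|lborel. std_normal_density u * autocorrelation f (\<epsilon> / (2 * pi) * u))"
    using assms by (intro integral_gaussian_autocorrelation) simp
  finally show ?eq .
qed

text \<open>The damping factors increase to 1 as \<open>\<epsilon>\<close> decreases. Convergence of
  the damped integrals therefore gives, by monotone convergence, both integrability of the undamped
  energy and its value.\<close>

theorem real_plancherel:
  shows "integrable lborel (\<lambda>w. (norm (cosine_transform f w))\<^sup>2 + (norm (sine_transform f w))\<^sup>2)"
    and "(LINT w|lborel. (norm (cosine_transform f w))\<^sup>2 + (norm (sine_transform f w))\<^sup>2) =
      (LINT t|lborel. (norm (f t))\<^sup>2)"
proof -
  define \<epsilon> where "\<epsilon> = (\<lambda>n. inverse (real (Suc n)))"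
  have \<epsilon>: "\<epsilon> n > 0" for n by (simp add: \<epsilon>_def)
  have \<epsilon>_lim: "\<epsilon> \<longlonglongrightarrow> 0" unfolding \<epsilon>_def by (rule LIMSEQ_inverse_real_of_nat)
  let ?e = "\<lambda>w. (norm (cosine_transform f w))\<^sup>2 + (norm (sine_transform f w))\<^sup>2"
  have [measurable]: "cosine_transform f \<in> borel_measurable borel" "sine_transform f \<in> borel_measurable borel"
    using continuous_cosine_transform[OF f_int] continuous_sine_transform[OF f_int]
    by (auto intro: borel_measurable_continuous_onI)
  have ilim: "(\<lambda>n. LINT w|lborel. exp (- (\<epsilon> n * w)\<^sup>2 / 2) * ?e w) \<longlonglongrightarrow> (LINT t|lborel. (norm (f t))\<^sup>2)"
  proof -
    let ?E = "LINT t|lborel. (norm (f t))\<^sup>2"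
    have "(\<lambda>n. LINT u|lborel. std_normal_density u * autocorrelation f (\<epsilon> n / (2 * pi) * u))
        \<longlonglongrightarrow> (LINT u|lborel. std_normal_density u * ?E)"
    \<comment> \<open>For fixed \<open>u\<close> the argument of the autocorrelation tends to 0; the
      standard normal weight has mass 1, so the limit is the energy itself.\<close>
    proof (rule integral_dominated_convergence[where w="\<lambda>u. std_normal_density u * ?E"])
      show "AE u in lborel. (\<lambda>n. std_normal_density u * autocorrelation f (\<epsilon> n / (2 * pi) * u)) \<longlonglongrightarrow> std_normal_density u * ?E"
        by (intro AE_I2 tendsto_mult_left tendsto_autocorrelation tendsto_mult_left_zero tendsto_divide_zero \<epsilon>_lim)
      show "AE u in lborel. norm (std_normal_density u * autocorrelation f (\<epsilon> n / (2 * pi) * u)) \<le> std_normal_density u * ?E" for n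
        using autocorrelation_bounded by (auto simp: abs_mult intro!: AE_I2 mult_left_mono)
    qed auto
    then show ?thesis
      unfolding integral_damped_energy(2)[OF \<epsilon>] by simp
  qed
  have mono: "AE w in lborel. mono (\<lambda>n. exp (- (\<epsilon> n * w)\<^sup>2 / 2) * ?e w)"
  proof (rule AE_I2, rule monoI)
    fix w :: real and m n :: nat assume "m \<le> n"
    then have "\<epsilon> n \<le> \<epsilon> m" by (simp add: \<epsilon>_def)
    then have "(\<epsilon> n * w)\<^sup>2 \<le> (\<epsilon> m * w)\<^sup>2"
      using \<epsilon>[of n] by (simp add: power_mult_distrib mult_right_mono power_mono)
    then show "exp (- (\<epsilon> m * w)\<^sup>2 / 2) * ?e w \<le> exp (- (\<epsilon> n * w)\<^sup>2 / 2) * ?e w"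
      by (intro mult_right_mono) auto
  qed
  have lim: "AE w in lborel. (\<lambda>n. exp (- (\<epsilon> n * w)\<^sup>2 / 2) * ?e w) \<longlonglongrightarrow> ?e w"
  proof (rule AE_I2)
    fix w
    have "(\<lambda>n. exp (- (\<epsilon> n * w)\<^sup>2 / 2) * ?e w) \<longlonglongrightarrow> exp (- (0 * w)\<^sup>2 / 2) * ?e w"
      by (intro tendsto_intros \<epsilon>_lim) auto
    then show "(\<lambda>n. exp (- (\<epsilon> n * w)\<^sup>2 / 2) * ?e w) \<longlonglongrightarrow> ?e w" by simp
  qed
  show "integrable lborel ?e" "(LINT w|lborel. ?e w) = (LINT t|lborel. (norm (f t))\<^sup>2)"
    using integrable_monotone_convergence[OF integral_damped_energy(1)[OF \<epsilon>] mono lim ilim]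
      integral_monotone_convergence[OF integral_damped_energy(1)[OF \<epsilon>] mono lim ilim] by simp_all
qed

end

section \<open>Quaternionic square integrable functions\<close>

text \<open>Equal weights give closure of L2 under addition. Weights just above the norms of the two
  summands give, after integration, the triangle inequality without Hoelder.\<close>

lemma norm_add_square_le:
  fixes x y :: "'a::real_normed_vector"
  assumes "p > 0" "q > 0"
  shows "(norm (x + y))\<^sup>2 \<le> (1 + q / p) * (norm x)\<^sup>2 + (1 + p / q) * (norm y)\<^sup>2"
proof -
  have "0 \<le> (q * norm x - p * norm y)\<^sup>2 / (p * q)"
    using assms by simp
  also have "\<dots> = q / p * (norm x)\<^sup>2 + p / q * (norm y)\<^sup>2 - 2 * norm x * norm y"
    using assms by (simp add: power2_eq_square field_simps)
  finally have "(norm x + norm y)\<^sup>2 \<le> (1 + q / p) * (norm x)\<^sup>2 + (1 + p / q) * (norm y)\<^sup>2"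
    by (simp add: power2_sum algebra_simps)
  moreover have "(norm (x + y))\<^sup>2 \<le> (norm x + norm y)\<^sup>2"
    by (intro power_mono norm_triangle_ineq) simp
  ultimately show ?thesis by (rule order_trans[rotated])
qed

lemma L2_quat_measurable: "f \<in> L2_quat \<Longrightarrow> f \<in> borel_measurable lebesgue"
  and L2_quat_integrable: "f \<in> L2_quat \<Longrightarrow> integrable lebesgue (\<lambda>t. (norm (f t))\<^sup>2)"
  by (simp_all add: L2_quat_def)

lemma L2_quat_bounded:
  assumes "integrable lebesgue b" "f \<in> borel_measurable lebesgue" "\<And>t. (norm (f t))\<^sup>2 \<le> b t"
  shows "f \<in> L2_quat"
proof -
  have "integrable lebesgue (\<lambda>t. (norm (f t))\<^sup>2)"
  proof (rule Bochner_Integration.integrable_bound[OF assms(1)])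
    show "AE t in lebesgue. norm ((norm (f t))\<^sup>2) \<le> norm (b t)"
      using assms(3) by (intro AE_I2) (simp add: order_trans[OF assms(3)])
  qed (use assms(2) in measurable)
  then show ?thesis using assms(2) by (simp add: L2_quat_def)
qed

lemma L2_quat_add:
  assumes f: "f \<in> L2_quat" and g: "g \<in> L2_quat"
  shows "(\<lambda>t. f t + g t) \<in> L2_quat"
proof (rule L2_quat_bounded)
  show "integrable lebesgue (\<lambda>t. (1 + 1 / 1) * (norm (f t))\<^sup>2 + (1 + 1 / 1) * (norm (g t))\<^sup>2)"
    using assms by (simp add: L2_quat_integrable)
  show "(norm (f t + g t))\<^sup>2 \<le> (1 + 1 / 1) * (norm (f t))\<^sup>2 + (1 + 1 / 1) * (norm (g t))\<^sup>2" for t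
    by (rule norm_add_square_le) auto
qed (rule borel_measurable_add[OF L2_quat_measurable[OF f] L2_quat_measurable[OF g]])

lemma L2_quat_mult_right:
  assumes "f \<in> L2_quat"
  shows "(\<lambda>t. f t * c) \<in> L2_quat"
proof (rule L2_quat_bounded)
  show "integrable lebesgue (\<lambda>t. (norm c)\<^sup>2 * (norm (f t))\<^sup>2)"
    using assms by (simp add: L2_quat_integrable)
qed (use assms in \<open>auto dest!: L2_quat_measurable simp: norm_mult power_mult_distrib\<close>)

lemma L2_quat_diff:
  assumes "f \<in> L2_quat" "g \<in> L2_quat"
  shows "(\<lambda>t. f t - g t) \<in> L2_quat"
  using L2_quat_add[OF assms(1) L2_quat_mult_right[OF assms(2), of "-1"]] by simp

lemma L2_quat_norm_nonneg [simp]: "0 \<le> L2_quat_norm f"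
  by (simp add: L2_quat_norm_def)

lemma L2_quat_norm_square: "(L2_quat_norm f)\<^sup>2 = (LINT t|lebesgue. (norm (f t))\<^sup>2)"
  by (simp add: L2_quat_norm_def)

lemma L2_quat_norm_mult_right: "L2_quat_norm (\<lambda>t. f t * c) = L2_quat_norm f * norm c"
  by (simp add: L2_quat_norm_def norm_mult power_mult_distrib real_sqrt_mult)

lemma L2_quat_norm_minus_commute: "L2_quat_norm (\<lambda>t. f t - g t) = L2_quat_norm (\<lambda>t. g t - f t)"
  by (simp add: L2_quat_norm_def norm_minus_commute)

lemma L2_quat_norm_triangle:
  assumes f: "f \<in> L2_quat" and g: "g \<in> L2_quat"
  shows "L2_quat_norm (\<lambda>t. f t + g t) \<le> L2_quat_norm f + L2_quat_norm g"
proof (rule field_le_epsilon)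
  fix e :: real assume "e > 0"
  \<comment> \<open>The summand \<open>e / 2\<close> makes both weights positive even if a norm
    vanishes, so that the quotients are meaningful.\<close>
  define p where "p = L2_quat_norm f + e / 2"
  define q where "q = L2_quat_norm g + e / 2"
  have pq: "p > 0" "q > 0" "L2_quat_norm f \<le> p" "L2_quat_norm g \<le> q"
    using \<open>e > 0\<close> by (auto simp: p_def q_def add_nonneg_pos)
  have "(L2_quat_norm (\<lambda>t. f t + g t))\<^sup>2 \<le>
      (LINT t|lebesgue. (1 + q / p) * (norm (f t))\<^sup>2 + (1 + p / q) * (norm (g t))\<^sup>2)"
    unfolding L2_quat_norm_square using pq f g
    by (intro integral_mono norm_add_square_le L2_quat_integrable L2_quat_add
      Bochner_Integration.integrable_add integrable_mult_right) auto
  also have "\<dots> = (1 + q / p) * (L2_quat_norm f)\<^sup>2 + (1 + p / q) * (L2_quat_norm g)\<^sup>2"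
    using f g by (simp add: L2_quat_norm_square L2_quat_integrable)
  also have "\<dots> \<le> (1 + q / p) * p\<^sup>2 + (1 + p / q) * q\<^sup>2"
    using pq by (intro add_mono mult_left_mono power_mono) auto
  also have "\<dots> = (p + q)\<^sup>2"
  proof -
    have "q / p * p\<^sup>2 = q * p" "p / q * q\<^sup>2 = p * q"
      using pq by (simp_all add: power2_eq_square)
    then show ?thesis
      by (simp only: distrib_right power2_sum mult_1_left) simp
  qed
  finally have "L2_quat_norm (\<lambda>t. f t + g t) \<le> p + q"
    by (rule power2_le_imp_le) (use pq in auto)
  then show "L2_quat_norm (\<lambda>t. f t + g t) \<le> L2_quat_norm f + L2_quat_norm g + e"
    by (simp add: p_def q_def)
qed

lemma L2_quat_norm_diff_triangle:
  assumes "f \<in> L2_quat" "g \<in> L2_quat" "h \<in> L2_quat"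
  shows "L2_quat_norm (\<lambda>t. f t - h t) \<le> L2_quat_norm (\<lambda>t. f t - g t) + L2_quat_norm (\<lambda>t. g t - h t)"
  using L2_quat_norm_triangle[OF L2_quat_diff[OF assms(1,2)] L2_quat_diff[OF assms(2,3)]] by simp

lemma L2_quat_norm_tendsto:
  assumes "\<And>n. a n \<in> L2_quat" "b \<in> L2_quat" "(\<lambda>n. L2_quat_norm (\<lambda>t. a n t - b t)) \<longlonglongrightarrow> 0"
  shows "(\<lambda>n. L2_quat_norm (a n)) \<longlonglongrightarrow> L2_quat_norm b"
proof (rule LIM_zero_cancel, rule Lim_null_comparison[OF _ assms(3)], intro always_eventually allI)
  fix n
  have "L2_quat_norm (a n) \<le> L2_quat_norm (\<lambda>t. a n t - b t) + L2_quat_norm b"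
    using L2_quat_norm_triangle[OF L2_quat_diff[OF assms(1,2)] assms(2), of n] by simp
  moreover have "L2_quat_norm b \<le> L2_quat_norm (\<lambda>t. a n t - b t) + L2_quat_norm (a n)"
    using L2_quat_norm_triangle[OF L2_quat_diff[OF assms(2,1)] assms(1), of n n]
    by (simp add: L2_quat_norm_minus_commute)
  ultimately show "norm (L2_quat_norm (a n) - L2_quat_norm b) \<le> L2_quat_norm (\<lambda>t. a n t - b t)"
    by simp
qed

section \<open>Polarization and the components of the inner product\<close>

lemma L2_quat_real_polarization:
  assumes f: "f \<in> L2_quat" and g: "g \<in> L2_quat"
  shows "integrable lebesgue (\<lambda>t. inner (f t) (g t))"
    and "(LINT t|lebesgue. inner (f t) (g t)) =
      ((L2_quat_norm f)\<^sup>2 + (L2_quat_norm g)\<^sup>2 - (L2_quat_norm (\<lambda>t. f t - g t))\<^sup>2) / 2"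
proof -
  have eq: "inner (f t) (g t) = ((norm (f t))\<^sup>2 + (norm (g t))\<^sup>2 - (norm (f t - g t))\<^sup>2) / 2" for t
    by (simp add: power2_norm_eq_inner inner_simps inner_commute)
  note int = f[THEN L2_quat_integrable] g[THEN L2_quat_integrable] L2_quat_diff[OF f g, THEN L2_quat_integrable]
  show "integrable lebesgue (\<lambda>t. inner (f t) (g t))"
    unfolding eq using int by simp
  show "(LINT t|lebesgue. inner (f t) (g t)) =
      ((L2_quat_norm f)\<^sup>2 + (L2_quat_norm g)\<^sup>2 - (L2_quat_norm (\<lambda>t. f t - g t))\<^sup>2) / 2"
    unfolding eq L2_quat_norm_square using int by simp
qed

text \<open>Left multiplications by \<open>g\<close> and \<open>qcnj g\<close> are adjoint for the
  real inner product. Every component of the quaternionic inner product thus becomes a real one,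
  with \<open>e\<close> on the right of \<open>g\<close>.\<close>

lemma inner_qcnj_mult: "inner (qcnj g * f) e = inner f (g * e)"
  by (simp add: inner_quat_def algebra_simps)

lemma integrable_qcnj_mult:
  assumes f: "f \<in> L2_quat" and g: "g \<in> L2_quat"
  shows "integrable lebesgue (\<lambda>t. qcnj (g t) * f t)"
proof -
  have "qcnj (g t) * f t = (\<Sum>e\<in>Basis. inner (f t) (g t * e) *\<^sub>R e)" for t
    by (simp add: inner_qcnj_mult[symmetric] euclidean_representation)
  then show ?thesis
    using L2_quat_real_polarization(1)[OF f L2_quat_mult_right[OF g]] by simp
qed

lemma inner_L2_quat_inner:
  assumes f: "f \<in> L2_quat" and g: "g \<in> L2_quat"
  shows "inner (L2_quat_inner f g) e =
    ((L2_quat_norm f)\<^sup>2 + (L2_quat_norm (\<lambda>t. g t * e))\<^sup>2 - (L2_quat_norm (\<lambda>t. f t - g t * e))\<^sup>2) / 2"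
proof -
  have "inner (L2_quat_inner f g) e = (LINT t|lebesgue. inner (qcnj (g t) * f t) e)"
    unfolding L2_quat_inner_def using integrable_qcnj_mult[OF f g] by simp
  then show ?thesis
    by (simp add: inner_qcnj_mult L2_quat_real_polarization(2)[OF f L2_quat_mult_right[OF g]])
qed

section \<open>Completeness of L2 and density of the integrable functions\<close>

lemma nn_integral_L2_quat_norm:
  "f \<in> L2_quat \<Longrightarrow> (\<integral>\<^sup>+t. ennreal ((norm (f t))\<^sup>2) \<partial>lebesgue) = ennreal ((L2_quat_norm f)\<^sup>2)"
  unfolding L2_quat_norm_square by (intro nn_integral_eq_integral L2_quat_integrable) auto

text \<open>Riesz-Fischer for a rapidly Cauchy sequence: the increments are summable almost
  everywhere, and Fatou shows that the pointwise limit is also the limit in norm.\<close>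

lemma L2_quat_complete:
  assumes g: "\<And>k. g k \<in> L2_quat"
    and cauchy: "\<And>k m. k \<le> m \<Longrightarrow> L2_quat_norm (\<lambda>t. g m t - g k t) \<le> (1/2) ^ k"
  shows "\<exists>h\<in>L2_quat. (\<lambda>k. L2_quat_norm (\<lambda>t. g k t - h t)) \<longlonglongrightarrow> 0"
proof -
  have [measurable]: "g k \<in> borel_measurable lebesgue" for k
    using g by (rule L2_quat_measurable)
  have nn_le: "(\<integral>\<^sup>+t. ennreal ((norm (g m t - g k t))\<^sup>2) \<partial>lebesgue) \<le> ennreal ((1/4) ^ k)" if "k \<le> m" for k m
  proof -
    have "(L2_quat_norm (\<lambda>t. g m t - g k t))\<^sup>2 \<le> ((1/2) ^ k)\<^sup>2"
      using cauchy[OF that] by (intro power_mono) auto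
    also have "\<dots> = (1/4) ^ k"
      by (simp add: power2_eq_square flip: power_mult_distrib)
    finally show ?thesis
      using nn_integral_L2_quat_norm[OF L2_quat_diff[OF g g], of m k] by (simp add: ennreal_leI)
  qed
  \<comment> \<open>The squared increments integrate to at most \<open>(1/4) ^ k\<close>, so the
    weight \<open>2 ^ k\<close> still leaves a convergent geometric series.\<close>
  let ?w = "\<lambda>k t. 2 ^ k * (norm (g (Suc k) t - g k t))\<^sup>2"
  have "(\<integral>\<^sup>+t. (\<Sum>k. ennreal (?w k t)) \<partial>lebesgue) = (\<Sum>k. \<integral>\<^sup>+t. ennreal (?w k t) \<partial>lebesgue)"
    by (intro nn_integral_suminf) measurable
  also have "\<dots> \<le> (\<Sum>k. ennreal ((1/2) ^ k))"
  proof (intro suminf_le allI)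
    fix k
    have "(\<integral>\<^sup>+t. ennreal (?w k t) \<partial>lebesgue) =
        ennreal (2 ^ k) * (\<integral>\<^sup>+t. ennreal ((norm (g (Suc k) t - g k t))\<^sup>2) \<partial>lebesgue)"
      by (subst nn_integral_cmult[symmetric]) (auto simp: ennreal_mult)
    also have "\<dots> \<le> ennreal (2 ^ k) * ennreal ((1/4) ^ k)"
      by (intro mult_left_mono nn_le) auto
    also have "\<dots> = ennreal ((1/2) ^ k)"
      by (simp flip: ennreal_mult power_mult_distrib)
    finally show "(\<integral>\<^sup>+t. ennreal (?w k t) \<partial>lebesgue) \<le> ennreal ((1/2) ^ k)" .
  qed auto
  also have "\<dots> < \<infinity>"
    by (simp add: suminf_ennreal2)
  finally have "AE t in lebesgue. (\<Sum>k. ennreal (?w k t)) \<noteq> \<infinity>"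
    by (intro nn_integral_PInf_AE) auto
  then have conv: "AE t in lebesgue. (\<lambda>k. g k t) \<longlonglongrightarrow> lim (\<lambda>k. g k t)"
  proof eventually_elim
    case (elim t)
    have sw: "summable (\<lambda>k. ?w k t)"
      using elim by (intro summable_suminf_not_top) auto
    have "summable (\<lambda>k. norm (g (Suc k) t - g k t))"
    proof (rule summable_comparison_test')
      show "summable (\<lambda>k. (1/2) ^ k + ?w k t)"
        by (intro summable_add sw summable_geometric) simp
      fix k
      define x where "x = norm (g (Suc k) t - g k t)"
      \<comment> \<open>Yields \<open>x \<le> (1/2) ^ k + 2 ^ k * x\<^sup>2\<close>, which passes
        from summable weighted squares to summable increments.\<close>
      have "0 \<le> (1 - 2 ^ k * x)\<^sup>2 + 1 + (2 ^ k * x)\<^sup>2"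
        by simp
      then have "2 ^ k * x \<le> 1 + (2 ^ k * x)\<^sup>2"
        by (simp add: power2_eq_square algebra_simps)
      then have "(1/2) ^ k * (2 ^ k * x) \<le> (1/2) ^ k * (1 + (2 ^ k * x)\<^sup>2)"
        by (intro mult_left_mono) auto
      then show "norm (norm (g (Suc k) t - g k t)) \<le> (1/2) ^ k + ?w k t"
        unfolding x_def[symmetric] by (simp add: x_def power_divide power2_eq_square field_simps)
    qed
    then have "summable (\<lambda>k. g (Suc k) t - g k t)"
      by (rule summable_norm_cancel)
    then have "convergent (\<lambda>n. g n t - g 0 t)"
      by (simp add: summable_iff_convergent sum_lessThan_telescope[of "\<lambda>k. g k t"])
    from convergent_add[OF this convergent_const[of "g 0 t"]] show ?case
      by (simp add: convergent_LIMSEQ_iff)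
  qed
  \<comment> \<open>Where the sequence diverges \<open>lim\<close> has an unspecified value; this
    happens only on a null set.\<close>
  define h where "h t = lim (\<lambda>k. g k t)" for t
  have [measurable]: "h \<in> borel_measurable lebesgue"
    unfolding h_def by (rule borel_measurable_lim_metric) measurable
  have fatou: "(\<integral>\<^sup>+t. ennreal ((norm (h t - g k t))\<^sup>2) \<partial>lebesgue) \<le> ennreal ((1/4) ^ k)" for k
  proof -
    have "(\<integral>\<^sup>+t. ennreal ((norm (h t - g k t))\<^sup>2) \<partial>lebesgue) =
        (\<integral>\<^sup>+t. liminf (\<lambda>m. ennreal ((norm (g m t - g k t))\<^sup>2)) \<partial>lebesgue)"
    proof (rule nn_integral_cong_AE, use conv in eventually_elim)
      case (elim t)
      have "(\<lambda>m. ennreal ((norm (g m t - g k t))\<^sup>2)) \<longlonglongrightarrow> ennreal ((norm (h t - g k t))\<^sup>2)"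
        unfolding h_def by (intro tendsto_intros tendsto_ennrealI elim)
      then show ?case
        by (intro lim_imp_Liminf[symmetric]) auto
    qed
    also have "\<dots> \<le> liminf (\<lambda>m. \<integral>\<^sup>+t. ennreal ((norm (g m t - g k t))\<^sup>2) \<partial>lebesgue)"
      by (rule nn_integral_liminf) measurable
    also have "\<dots> \<le> liminf (\<lambda>m::nat. ennreal ((1/4) ^ k))"
      by (rule Liminf_mono) (auto simp: eventually_sequentially intro!: exI[of _ k] nn_le)
    also have "\<dots> = ennreal ((1/4) ^ k)"
      by (simp add: Liminf_const)
    finally show ?thesis .
  qed
  have d: "(\<lambda>t. h t - g k t) \<in> L2_quat" for k
  proof -
    have "integrable lebesgue (\<lambda>t. (norm (h t - g k t))\<^sup>2)"
      using fatou[of k] by (intro integrableI_nonneg) (auto intro: le_less_trans)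
    then show ?thesis by (simp add: L2_quat_def)
  qed
  have hL2: "h \<in> L2_quat"
    using L2_quat_add[OF d[of 0] g[of 0]] by simp
  moreover have "(\<lambda>k. L2_quat_norm (\<lambda>t. g k t - h t)) \<longlonglongrightarrow> 0"
  proof (rule Lim_null_comparison)
    show "(\<lambda>k. (1/2::real) ^ k) \<longlonglongrightarrow> 0"
      by (rule LIMSEQ_power_zero) simp
    show "\<forall>\<^sub>F k in sequentially. norm (L2_quat_norm (\<lambda>t. g k t - h t)) \<le> (1/2) ^ k"
    proof (intro always_eventually allI)
      fix k
      have "(L2_quat_norm (\<lambda>t. h t - g k t))\<^sup>2 \<le> (1/4) ^ k"
        using fatou[of k] nn_integral_L2_quat_norm[OF d, of k] by (simp add: ennreal_le_iff)
      also have "\<dots> = ((1/2) ^ k)\<^sup>2"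
        by (simp add: power2_eq_square flip: power_mult_distrib)
      finally have "L2_quat_norm (\<lambda>t. h t - g k t) \<le> (1/2) ^ k"
        by (rule power2_le_imp_le) simp
      then show "norm (L2_quat_norm (\<lambda>t. g k t - h t)) \<le> (1/2) ^ k"
        by (simp add: L2_quat_norm_minus_commute[of "g k"])
    qed
  qed
  ultimately show ?thesis by blast
qed

text \<open>Cutting off to \<open>{- real n..real n}\<close> works: on a set of finite measure
  \<open>x \<le> 1 + x\<^sup>2\<close> makes a square integrable function integrable, and at each
  point the cut-off is eventually inactive.\<close>

lemma L2_quat_dense:
  assumes f: "f \<in> L2_quat"
  shows "\<exists>h. (\<forall>n. h n \<in> L1_quat \<inter> L2_quat) \<and> (\<lambda>n. L2_quat_norm (\<lambda>t. h n t - f t)) \<longlonglongrightarrow> 0"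
proof (intro exI conjI allI)
  let ?h = "\<lambda>n t. indicator {- real n..real n} t *\<^sub>R f t"
  have [measurable]: "f \<in> borel_measurable lebesgue"
    using f by (rule L2_quat_measurable)
  have [measurable]: "{a..b::real} \<in> sets lebesgue" for a b by simp
  have hm [measurable]: "?h n \<in> borel_measurable lebesgue" for n
    by measurable
  show "?h n \<in> L1_quat \<inter> L2_quat" for n
  proof
    have "integrable lebesgue (?h n)"
    proof (rule Bochner_Integration.integrable_bound)
      show "integrable lebesgue (\<lambda>t. indicator {- real n..real n} t + (norm (f t))\<^sup>2)"
        using L2_quat_integrable[OF f] by (intro Bochner_Integration.integrable_add integrable_real_indicator) auto
      have x: "x \<le> 1 + x\<^sup>2" for x :: real
        using zero_le_power2[of "x - 1"] zero_le_power2[of "x + 1"]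
        unfolding power2_diff power2_sum power_one by linarith
      show "AE t in lebesgue. norm (?h n t) \<le> norm (indicator {- real n..real n} t + (norm (f t))\<^sup>2)"
        using x by (intro AE_I2) (auto simp: indicator_def)
    qed measurable
    then show "?h n \<in> L1_quat" by (simp add: L1_quat_def)
    show "?h n \<in> L2_quat"
      by (rule L2_quat_bounded[OF L2_quat_integrable[OF f]]) (rule hm, simp add: indicator_def)
  qed
  have "(\<lambda>n. LINT t|lebesgue. (norm (?h n t - f t))\<^sup>2) \<longlonglongrightarrow> (LINT t|(lebesgue::real measure). 0)"
  proof (rule integral_dominated_convergence[OF _ _ L2_quat_integrable[OF f]])
    show "(\<lambda>t. (norm (?h n t - f t))\<^sup>2) \<in> borel_measurable lebesgue" for n
      by measurable
    show "AE t in lebesgue. (\<lambda>n. (norm (?h n t - f t))\<^sup>2) \<longlonglongrightarrow> 0"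
    proof (rule AE_I2, rule tendsto_eventually)
      fix t
      obtain N where "\<bar>t\<bar> \<le> real N" using real_arch_simple by blast
      then show "eventually (\<lambda>n. (norm (?h n t - f t))\<^sup>2 = 0) sequentially"
        unfolding eventually_sequentially by (intro exI[of _ N]) (auto simp: indicator_def)
    qed
  qed (auto simp: indicator_def)
  then have "(\<lambda>n. sqrt (LINT t|lebesgue. (norm (?h n t - f t))\<^sup>2)) \<longlonglongrightarrow> sqrt 0"
    by (intro tendsto_real_sqrt) simp
  then show "(\<lambda>n. L2_quat_norm (\<lambda>t. ?h n t - f t)) \<longlonglongrightarrow> 0"
    by (simp add: L2_quat_norm_def)
qed

section \<open>The quaternion Fourier transform\<close>

text \<open>The real-valued case is applied to each coordinate; there are finitely many, so the
  exceptional sets unite to a null set.\<close>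

lemma completion_ex_borel_measurable_euclidean:
  fixes f :: "'a \<Rightarrow> 'b::euclidean_space"
  assumes f: "f \<in> borel_measurable (completion M)"
  shows "\<exists>g\<in>borel_measurable M. AE x in M. f x = g x"
proof -
  have "\<exists>g\<in>borel_measurable M. AE x in M. inner (f x) b = g x" for b
    using f by (intro completion_ex_borel_measurable_real borel_measurable_inner) auto
  then obtain g where [measurable]: "\<And>b. g b \<in> borel_measurable M"
    and g: "\<And>b. AE x in M. inner (f x) b = g b x"
    by metis
  have "AE x in M. \<forall>b\<in>Basis. inner (f x) b = g b x"
    using g by (intro AE_finite_allI) auto
  then have "AE x in M. f x = (\<Sum>b\<in>Basis. g b x *\<^sub>R b)"
  proof eventually_elim
    case (elim x)
    then show ?case
      by (subst euclidean_representation[symmetric]) simp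
  qed
  then show ?thesis
    by (intro bexI[of _ "\<lambda>x. \<Sum>b\<in>Basis. g b x *\<^sub>R b"]) auto
qed

text \<open>\<open>z \<mapsto> Re z + Im z I\<close> is a continuous algebra homomorphism from the complex numbers, hence
  commutes with \<open>exp\<close>.\<close>

lemma exp_scaleR_imaginary_unit:
  fixes I :: "'a::{real_normed_algebra_1, banach}"
  assumes I: "I * I = - 1"
  shows "exp (a *\<^sub>R I) = cos a *\<^sub>R 1 + sin a *\<^sub>R I"
proof -
  define h where "h z = Re z *\<^sub>R 1 + Im z *\<^sub>R I" for z
  have bl: "bounded_linear h"
    unfolding h_def
    by (intro bounded_linear_add bounded_linear_scaleR_const bounded_linear_Re bounded_linear_Im)
  have mult: "h (z * w) = h z * h w" for z w
    by (simp add: h_def algebra_simps I)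
  have pow: "h (z ^ n) = h z ^ n" for z n
    by (induction n) (simp_all add: mult, simp add: h_def)
  have "(\<lambda>n. h (z ^ n /\<^sub>R fact n)) sums h (exp z)" for z
    by (rule bounded_linear.sums[OF bl exp_converges])
  then have "(\<lambda>n. h z ^ n /\<^sub>R fact n) sums h (exp z)" for z
    by (simp add: pow linear_cmul[OF bounded_linear.linear[OF bl]])
  then have "h (exp z) = exp (h z)" for z
    using exp_converges sums_unique2 by blast
  from this[of "\<i> * of_real a"] show ?thesis
    by (simp add: h_def Re_exp Im_exp)
qed

lemma norm_quat_sphere: "I \<in> quat_sphere \<Longrightarrow> norm I = 1"
proof -
  assume "I \<in> quat_sphere"
  then have "norm (I\<^sup>2) = norm (- 1 :: quat)"
    by (simp add: quat_sphere_def)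
  then show ?thesis
    by (simp add: norm_power power2_eq_1_iff) (smt (verit) norm_ge_zero)
qed

lemma qft_kernel:
  assumes "I \<in> quat_sphere"
  shows "exp ((- 2 * pi * w * t) *\<^sub>R I) * q = cos (2 * pi * w * t) *\<^sub>R q - sin (2 * pi * w * t) *\<^sub>R (I * q)"
proof -
  have "I * I = - 1"
    using assms by (simp add: quat_sphere_def power2_eq_square)
  then have "exp ((- 2 * pi * w * t) *\<^sub>R I) = cos (2 * pi * w * t) *\<^sub>R 1 - sin (2 * pi * w * t) *\<^sub>R I"
    by (subst exp_scaleR_imaginary_unit) simp_all
  then show ?thesis
    by (simp add: left_diff_distrib)
qed

lemma integrable_qft_kernel:
  fixes f :: "real \<Rightarrow> quat"
  assumes I: "I \<in> quat_sphere" and f: "integrable lebesgue f"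
  shows "integrable lebesgue (\<lambda>t. exp ((- 2 * pi * w * t) *\<^sub>R I) * f t)"
proof (rule Bochner_Integration.integrable_bound[OF integrable_mult_right[OF integrable_norm[OF f], of 2]])
  have [measurable]: "f \<in> borel_measurable lebesgue" using f by simp
  have "(\<lambda>t. exp ((- 2 * pi * w * t) *\<^sub>R I)) \<in> borel_measurable borel"
    \<comment> \<open>The case \<open>q = 1\<close> writes the exponential through cosine and sine,
      whose continuity gives measurability.\<close>
    unfolding qft_kernel[OF I, where q = 1, unfolded mult_1_right]
    by (intro borel_measurable_continuous_onI continuous_intros)
  then have [measurable]: "(\<lambda>t. exp ((- 2 * pi * w * t) *\<^sub>R I)) \<in> borel_measurable lebesgue"
    by (intro measurable_completion) simp
  show "(\<lambda>t. exp ((- 2 * pi * w * t) *\<^sub>R I) * f t) \<in> borel_measurable lebesgue"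
    by measurable
  \<comment> \<open>The constant 2 comes from estimating the cosine and sine parts separately; any
    fixed constant serves for domination.\<close>
  have "norm (exp ((- 2 * pi * w * t) *\<^sub>R I) * q) \<le> 2 * norm q" for t q
  proof -
    have "norm (exp ((- 2 * pi * w * t) *\<^sub>R I) * q) \<le> norm (cos (2 * pi * w * t) *\<^sub>R q) + norm (sin (2 * pi * w * t) *\<^sub>R (I * q))"
      unfolding qft_kernel[OF I] by (rule norm_triangle_ineq4)
    also have "\<dots> \<le> norm q + norm q"
      using norm_quat_sphere[OF I] by (intro add_mono) (auto simp: norm_mult intro!: mult_left_le_one_le)
    finally show ?thesis by simp
  qed
  then show "AE t in lebesgue. norm (exp ((- 2 * pi * w * t) *\<^sub>R I) * f t) \<le> norm (2 * norm (f t))"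
    by simp
qed

text \<open>The integral ignores the null set on which \<open>f\<close> and \<open>g\<close> differ,
  so the identity holds at every frequency. \<open>I\<close> stays on the left of the sine transform
  because left multiplication is bounded and linear.\<close>

lemma qft_L1_borel_representative:
  assumes I: "I \<in> quat_sphere" and f: "integrable lebesgue f"
    and g: "g \<in> borel_measurable borel" "AE t in lborel. f t = g t"
  shows "qft_L1 I f w = cosine_transform g w - I * sine_transform g w"
proof -
  have [measurable]: "g \<in> borel_measurable borel" by fact
  have AE: "AE t in lebesgue. f t = g t"
    using g(2) by (rule AE_completion)
  have "integrable lebesgue g"
    using f AE by (subst integrable_cong_AE[of _ _ f]) (auto intro: measurable_completion)
  then have gi: "integrable lborel g"
    by (simp add: integrable_completion)
  note cs = integrable_cos_sin[OF gi, of "2 * pi * w"]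
  have Is: "integrable lborel (\<lambda>t. I * (sin (2 * pi * w * t) *\<^sub>R g t))"
    using cs(2) by (intro integrable_mult_right) 
  have "qft_L1 I f w = (LINT t|lebesgue. exp ((- 2 * pi * w * t) *\<^sub>R I) * g t)"
    unfolding qft_L1_def
  proof (rule integral_cong_AE)
    show "(\<lambda>t. exp ((- 2 * pi * w * t) *\<^sub>R I) * f t) \<in> borel_measurable lebesgue"
      "(\<lambda>t. exp ((- 2 * pi * w * t) *\<^sub>R I) * g t) \<in> borel_measurable lebesgue"
      by (rule borel_measurable_integrable[OF integrable_qft_kernel[OF I f]],
          rule borel_measurable_integrable[OF integrable_qft_kernel[OF I \<open>integrable lebesgue g\<close>]])
  qed (use AE in auto)
  also have "\<dots> = (LINT t|lborel. cos (2 * pi * w * t) *\<^sub>R g t - I * (sin (2 * pi * w * t) *\<^sub>R g t))"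
    unfolding qft_kernel[OF I] by (subst integral_completion) simp_all
  also have "\<dots> = cosine_transform g w - (LINT t|lborel. I * (sin (2 * pi * w * t) *\<^sub>R g t))"
    unfolding cosine_transform_def by (rule Bochner_Integration.integral_diff[OF cs(1) Is])
  also have "(LINT t|lborel. I * (sin (2 * pi * w * t) *\<^sub>R g t)) = I * sine_transform g w"
    unfolding sine_transform_def by (rule integral_bounded_linear[OF bounded_linear_mult_right cs(2)])
  finally show ?thesis .
qed

proposition qft_L1_plancherel:
  assumes I: "I \<in> quat_sphere" and f1: "f \<in> L1_quat" and f2: "f \<in> L2_quat"
  shows "qft_L1 I f \<in> L2_quat" "L2_quat_norm (qft_L1 I f) = L2_quat_norm f"
proof -
  have fm: "f \<in> borel_measurable lebesgue" using f2 by (rule L2_quat_measurable)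
  have fi: "integrable lebesgue f" using f1 by (simp add: L1_quat_def)
  obtain g where gm [measurable]: "g \<in> borel_measurable borel" and AE: "AE t in lborel. f t = g t"
    using completion_ex_borel_measurable_euclidean[OF fm] by auto
  have AEl: "AE t in lebesgue. f t = g t"
    using AE by (rule AE_completion)
  have "integrable lebesgue g"
    using fi AEl by (subst integrable_cong_AE[of _ _ f]) (auto intro: measurable_completion)
  then have gi: "integrable lborel g" by (simp add: integrable_completion)
  have sq_eq: "AE t in lebesgue. (norm (g t))\<^sup>2 = (norm (f t))\<^sup>2"
    using AEl by eventually_elim simp
  have gm': "g \<in> borel_measurable lebesgue" by (rule measurable_completion) simp
  have "integrable lebesgue (\<lambda>t. (norm (g t))\<^sup>2)"
    using L2_quat_integrable[OF f2] sq_eq fm gm'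
    by (subst integrable_cong_AE[of _ _ "\<lambda>t. (norm (f t))\<^sup>2"]) auto
  then have gsq: "integrable lborel (\<lambda>t. (norm (g t))\<^sup>2)"
    by (simp add: integrable_completion)
  have norm_g: "(LINT t|lborel. (norm (g t))\<^sup>2) = (L2_quat_norm f)\<^sup>2"
  proof -
    have "(LINT t|lborel. (norm (g t))\<^sup>2) = (LINT t|lebesgue. (norm (g t))\<^sup>2)"
      by (subst integral_completion) simp_all
    also have "\<dots> = (LINT t|lebesgue. (norm (f t))\<^sup>2)"
      using sq_eq fm gm' by (intro integral_cong_AE) auto
    finally show ?thesis by (simp add: L2_quat_norm_square)
  qed
  let ?C = "cosine_transform g" and ?S = "sine_transform g"
  let ?e = "\<lambda>w. (norm (?C w))\<^sup>2 + (norm (?S w))\<^sup>2"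
  have F: "qft_L1 I f = (\<lambda>w. ?C w - I * ?S w)"
    using qft_L1_borel_representative[OF I fi gm AE] by auto
  have [measurable]: "?C \<in> borel_measurable borel" "?S \<in> borel_measurable borel"
    using continuous_cosine_transform[OF gi] continuous_sine_transform[OF gi]
    by (auto intro: borel_measurable_continuous_onI)
  have [measurable]: "(\<lambda>w. ?C w - I * ?S w) \<in> borel_measurable borel"
    by (intro borel_measurable_diff borel_measurable_times borel_measurable_const) fact+
  note planch = L1_L2_function.real_plancherel[OF L1_L2_function.intro[OF gi gsq]]
  have par: "(norm (?C w - I * ?S w))\<^sup>2 + (norm (?C w + I * ?S w))\<^sup>2 = 2 * ?e w" for w
  proof -
    have "(norm (I * ?S w))\<^sup>2 = (norm (?S w))\<^sup>2"
      by (simp add: norm_mult norm_quat_sphere[OF I])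
    then show ?thesis
      by (simp add: power2_norm_eq_inner inner_simps inner_commute)
  qed
  have int: "integrable lborel (\<lambda>w. (norm (?C w - I * ?S w))\<^sup>2)"
  proof (rule Bochner_Integration.integrable_bound[OF integrable_mult_right[OF planch(1), of 2]])
    show "AE w in lborel. norm ((norm (?C w - I * ?S w))\<^sup>2) \<le> norm (2 * ?e w)"
      unfolding par[symmetric] by simp
  qed measurable
  \<comment> \<open>Reflection flips the sign of the cross term between \<open>?C w\<close> and
    \<open>I * ?S w\<close>. Equality of the two integrals expresses that this term contributes
    nothing.\<close>
  have refl_eq: "(norm (?C (- w) - I * ?S (- w)))\<^sup>2 = (norm (?C w + I * ?S w))\<^sup>2" for w
    by (simp add: cosine_transform_def sine_transform_def)
  have int': "integrable lborel (\<lambda>w. (norm (?C w + I * ?S w))\<^sup>2)"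
    using lborel_integrable_real_affine[OF int, of "-1" 0] by (simp add: refl_eq)
  have "(LINT w|lborel. (norm (?C w + I * ?S w))\<^sup>2) = (LINT w|lborel. (norm (?C w - I * ?S w))\<^sup>2)"
    using lborel_integral_real_affine[of "-1" "\<lambda>w. (norm (?C w - I * ?S w))\<^sup>2" 0] by (simp add: refl_eq)
  then have "2 * (LINT w|lborel. (norm (?C w - I * ?S w))\<^sup>2) =
      (LINT w|lborel. (norm (?C w - I * ?S w))\<^sup>2 + (norm (?C w + I * ?S w))\<^sup>2)"
    using int int' by simp
  also have "\<dots> = 2 * (L2_quat_norm f)\<^sup>2"
    unfolding par integral_mult_right_zero planch(2) norm_g ..
  finally have eq: "(LINT w|lborel. (norm (?C w - I * ?S w))\<^sup>2) = (L2_quat_norm f)\<^sup>2"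
    by simp
  have Fm: "(\<lambda>w. ?C w - I * ?S w) \<in> borel_measurable lebesgue"
    by (rule measurable_completion) simp
  have "integrable lebesgue (\<lambda>w. (norm (?C w - I * ?S w))\<^sup>2)"
    using int by (subst integrable_completion) simp_all
  with Fm show "qft_L1 I f \<in> L2_quat"
    unfolding F L2_quat_def by simp
  have "(LINT w|lebesgue. (norm (?C w - I * ?S w))\<^sup>2) = (L2_quat_norm f)\<^sup>2"
    using eq by (subst integral_completion) simp_all
  then show "L2_quat_norm (qft_L1 I f) = L2_quat_norm f"
    unfolding F by (subst L2_quat_norm_def) simp
qed

text \<open>The kernel acts from the left and \<open>e\<close> from the right, so associativity is
  enough and \<open>e\<close> is never moved past \<open>I\<close>.\<close>

lemma qft_L1_diff_mult_right:
  assumes I: "I \<in> quat_sphere" and "f \<in> L1_quat" "g \<in> L1_quat"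
  shows "qft_L1 I (\<lambda>t. f t - g t * e) w = qft_L1 I f w - qft_L1 I g w * e"
proof -
  let ?k = "\<lambda>t. exp ((- 2 * pi * w * t) *\<^sub>R I)"
  have f: "integrable lebesgue (\<lambda>t. ?k t * f t)" and g: "integrable lebesgue (\<lambda>t. ?k t * g t)"
    using integrable_qft_kernel[OF I, of f w] integrable_qft_kernel[OF I, of g w] assms(2,3)
    unfolding L1_quat_def by blast+
  have ge: "integrable lebesgue (\<lambda>t. ?k t * g t * e)"
    using g by (rule integrable_mult_left)
  have "qft_L1 I (\<lambda>t. f t - g t * e) w = (LINT t|lebesgue. ?k t * f t - ?k t * g t * e)"
    unfolding qft_L1_def by (simp only: right_diff_distrib mult.assoc)
  also have "\<dots> = (LINT t|lebesgue. ?k t * f t) - (LINT t|lebesgue. ?k t * g t * e)"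
    by (rule Bochner_Integration.integral_diff[OF f ge])
  also have "(LINT t|lebesgue. ?k t * g t * e) = (LINT t|lebesgue. ?k t * g t) * e"
    by (rule integral_bounded_linear[OF bounded_linear_mult_left g])
  finally show ?thesis by (simp add: qft_L1_def)
qed

lemma L1_L2_quat_diff_mult_right:
  assumes "f \<in> L1_quat \<inter> L2_quat" "g \<in> L1_quat \<inter> L2_quat"
  shows "(\<lambda>t. f t - g t * e) \<in> L1_quat \<inter> L2_quat"
  using assms by (auto simp: L1_quat_def intro: L2_quat_diff L2_quat_mult_right integrable_mult_left)

lemma L2_quat_norm_qft_L1_diff:
  assumes I: "I \<in> quat_sphere" and f: "f \<in> L1_quat \<inter> L2_quat" and g: "g \<in> L1_quat \<inter> L2_quat"
  shows "L2_quat_norm (\<lambda>w. qft_L1 I f w - qft_L1 I g w * e) = L2_quat_norm (\<lambda>t. f t - g t * e)"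
proof -
  have "(\<lambda>w. qft_L1 I f w - qft_L1 I g w * e) = qft_L1 I (\<lambda>t. f t - g t * e)"
    using f g by (intro ext qft_L1_diff_mult_right[OF I, symmetric]) auto
  then show ?thesis
    using qft_L1_plancherel(2)[OF I] L1_L2_quat_diff_mult_right[OF f g, of e] by simp
qed

section \<open>Extension of the transform to L2\<close>

lemma L2_quat_norm_tendsto_diff_mult:
  assumes a: "\<And>n. a n \<in> L2_quat" "f \<in> L2_quat" "(\<lambda>n. L2_quat_norm (\<lambda>t. a n t - f t)) \<longlonglongrightarrow> 0"
    and b: "\<And>n. b n \<in> L2_quat" "g \<in> L2_quat" "(\<lambda>n. L2_quat_norm (\<lambda>t. b n t - g t)) \<longlonglongrightarrow> 0"
  shows "(\<lambda>n. L2_quat_norm (\<lambda>t. a n t - b n t * e)) \<longlonglongrightarrow> L2_quat_norm (\<lambda>t. f t - g t * e)"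
proof (rule L2_quat_norm_tendsto)
  show "(\<lambda>t. a n t - b n t * e) \<in> L2_quat" for n
    by (intro L2_quat_diff L2_quat_mult_right a b)
  show "(\<lambda>t. f t - g t * e) \<in> L2_quat"
    by (intro L2_quat_diff L2_quat_mult_right a b)
  show "(\<lambda>n. L2_quat_norm (\<lambda>t. a n t - b n t * e - (f t - g t * e))) \<longlonglongrightarrow> 0"
  proof (rule Lim_null_comparison)
    show "(\<lambda>n. L2_quat_norm (\<lambda>t. a n t - f t) + L2_quat_norm (\<lambda>t. b n t - g t) * norm e) \<longlonglongrightarrow> 0"
      using tendsto_add[OF a(3) tendsto_mult_right[OF b(3), of "norm e"]] by simp
    show "\<forall>\<^sub>F n in sequentially. norm (L2_quat_norm (\<lambda>t. a n t - b n t * e - (f t - g t * e)))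
        \<le> L2_quat_norm (\<lambda>t. a n t - f t) + L2_quat_norm (\<lambda>t. b n t - g t) * norm e"
    proof (intro always_eventually allI)
      fix n
      have "L2_quat_norm (\<lambda>t. (a n t - f t) + (b n t - g t) * (- e))
          \<le> L2_quat_norm (\<lambda>t. a n t - f t) + L2_quat_norm (\<lambda>t. (b n t - g t) * (- e))"
        by (intro L2_quat_norm_triangle L2_quat_mult_right L2_quat_diff a b)
      also have "(\<lambda>t. (a n t - f t) + (b n t - g t) * (- e)) = (\<lambda>t. a n t - b n t * e - (f t - g t * e))"
        by (simp add: fun_eq_iff algebra_simps)
      finally show "norm (L2_quat_norm (\<lambda>t. a n t - b n t * e - (f t - g t * e)))
        \<le> L2_quat_norm (\<lambda>t. a n t - f t) + L2_quat_norm (\<lambda>t. b n t - g t) * norm e"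
        unfolding L2_quat_norm_mult_right norm_minus_cancel by simp
    qed
  qed
qed

text \<open>Distances to the transforms of a dense class determine \<open>g\<close> up to null sets.
  The condition thus singles out the transform of \<open>f\<close> without naming an approximating
  sequence.\<close>

lemma qft_L1_extends:
  assumes I: "I \<in> quat_sphere" and f: "f \<in> L2_quat"
  shows "\<exists>g\<in>L2_quat. \<forall>h\<in>L1_quat \<inter> L2_quat.
    L2_quat_norm (\<lambda>w. qft_L1 I h w - g w) = L2_quat_norm (\<lambda>t. h t - f t)"
proof -
  obtain a where a: "\<And>n. a n \<in> L1_quat \<inter> L2_quat" "(\<lambda>n. L2_quat_norm (\<lambda>t. a n t - f t)) \<longlonglongrightarrow> 0"
    using L2_quat_dense[OF f] by auto
  \<comment> \<open>Half of \<open>(1/2) ^ k\<close>, because the distance between two members of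
    the sequence is estimated through \<open>f\<close> by two such errors.\<close>
  have "\<exists>n. L2_quat_norm (\<lambda>t. a n t - f t) < (1/2) ^ k / 2" for k
    using order_tendstoD(2)[OF a(2), of "(1/2) ^ k / 2"] by (auto dest: eventually_happens)
  then obtain r where r: "\<And>k. L2_quat_norm (\<lambda>t. a (r k) t - f t) < (1/2) ^ k / 2"
    by metis
  define b where "b k = a (r k)" for k
  have bD: "b k \<in> L1_quat \<inter> L2_quat" for k using a(1) by (simp add: b_def)
  then have bL2: "b k \<in> L2_quat" for k by simp
  have FL2: "qft_L1 I h \<in> L2_quat" if "h \<in> L1_quat \<inter> L2_quat" for h
    using qft_L1_plancherel(1)[OF I] that by simp
  have iso: "L2_quat_norm (\<lambda>w. qft_L1 I h w - qft_L1 I k w) = L2_quat_norm (\<lambda>t. h t - k t)"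
    if "h \<in> L1_quat \<inter> L2_quat" "k \<in> L1_quat \<inter> L2_quat" for h k
    using L2_quat_norm_qft_L1_diff[OF I that, of 1] by simp
  have b_lim: "(\<lambda>k. L2_quat_norm (\<lambda>t. b k t - f t)) \<longlonglongrightarrow> 0"
  proof (rule Lim_null_comparison)
    show "(\<lambda>k. (1/2::real) ^ k / 2) \<longlonglongrightarrow> 0"
      by (intro tendsto_divide_zero LIMSEQ_power_zero) simp
  qed (use r in \<open>auto simp: b_def intro!: always_eventually less_imp_le\<close>)
  have "\<exists>g\<in>L2_quat. (\<lambda>k. L2_quat_norm (\<lambda>w. qft_L1 I (b k) w - g w)) \<longlonglongrightarrow> 0"
  proof (rule L2_quat_complete)
    show "qft_L1 I (b k) \<in> L2_quat" for k
      by (rule FL2[OF bD])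
    fix k m :: nat assume "k \<le> m"
    have "L2_quat_norm (\<lambda>w. qft_L1 I (b m) w - qft_L1 I (b k) w) = L2_quat_norm (\<lambda>t. b m t - b k t)"
      by (rule iso[OF bD bD])
    also have "\<dots> \<le> L2_quat_norm (\<lambda>t. b m t - f t) + L2_quat_norm (\<lambda>t. f t - b k t)"
      by (rule L2_quat_norm_diff_triangle[OF bL2 f bL2])
    also have "\<dots> \<le> (1/2) ^ m / 2 + (1/2) ^ k / 2"
      using r[of m] r[of k] unfolding L2_quat_norm_minus_commute[of f] b_def by simp
    also have "\<dots> \<le> (1/2) ^ k / 2 + (1/2) ^ k / 2"
      using \<open>k \<le> m\<close> by (intro add_mono divide_right_mono power_decreasing) auto
    finally show "L2_quat_norm (\<lambda>w. qft_L1 I (b m) w - qft_L1 I (b k) w) \<le> (1/2) ^ k"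
      by simp
  qed
  then obtain g where g: "g \<in> L2_quat" "(\<lambda>k. L2_quat_norm (\<lambda>w. qft_L1 I (b k) w - g w)) \<longlonglongrightarrow> 0"
    by blast
  show ?thesis
  proof (intro bexI[OF _ g(1)] ballI)
    fix h assume h: "h \<in> L1_quat \<inter> L2_quat"
    \<comment> \<open>The factor 1 and the constant sequence \<open>h\<close> fit the claim to the
      general convergence lemma.\<close>
    have "(\<lambda>k. L2_quat_norm (\<lambda>w. qft_L1 I h w - qft_L1 I (b k) w * 1)) \<longlonglongrightarrow> L2_quat_norm (\<lambda>w. qft_L1 I h w - g w * 1)"
      by (rule L2_quat_norm_tendsto_diff_mult) (use FL2[OF h] FL2[OF bD] g in \<open>simp_all add: L2_quat_norm_def\<close>)
    moreover have "(\<lambda>k. L2_quat_norm (\<lambda>t. h t - b k t * 1)) \<longlonglongrightarrow> L2_quat_norm (\<lambda>t. h t - f t * 1)"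
      by (rule L2_quat_norm_tendsto_diff_mult) (use h bL2 f b_lim in \<open>simp_all add: L2_quat_norm_def\<close>)
    ultimately show "L2_quat_norm (\<lambda>w. qft_L1 I h w - g w) = L2_quat_norm (\<lambda>t. h t - f t)"
      using LIMSEQ_unique by (fastforce simp: iso[OF h bD])
  qed
qed

lemma is_qft_extension_exists:
  assumes I: "I \<in> quat_sphere"
  shows "\<exists>T. is_qft_extension I T"
proof -
  define P where "P f g \<longleftrightarrow> g \<in> L2_quat \<and> (\<forall>h\<in>L1_quat \<inter> L2_quat.
    L2_quat_norm (\<lambda>w. qft_L1 I h w - g w) = L2_quat_norm (\<lambda>t. h t - f t))" for f g
  have P_L1: "P f (qft_L1 I f)" if f: "f \<in> L1_quat \<inter> L2_quat" for f
    using qft_L1_plancherel(1)[OF I] f L2_quat_norm_qft_L1_diff[OF I _ f, of _ 1] by (simp add: P_def)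
  \<comment> \<open>On integrable functions an extension must equal \<open>qft_L1 I f\<close> as a
    function, not merely almost everywhere, so the choice is made only elsewhere.\<close>
  define T where "T f = (if f \<in> L1_quat then qft_L1 I f else SOME g. P f g)" for f
  have PT: "P f (T f)" if f: "f \<in> L2_quat" for f
  proof (cases "f \<in> L1_quat")
    case True
    then show ?thesis using P_L1 f by (simp add: T_def)
  next
    case False
    have "\<exists>g. P f g"
      using qft_L1_extends[OF I f] unfolding P_def by blast
    then show ?thesis using False by (simp add: T_def someI_ex)
  qed
  have TL2: "T f \<in> L2_quat" if "f \<in> L2_quat" for f
    using PT[OF that] by (simp add: P_def)
  \<comment> \<open>Values of \<open>T\<close> are chosen one by one, so linearity of
    \<open>T\<close> is not at hand. Both values are compared with the transform of an integrable
    \<open>h\<close> close to \<open>f\<close>, where \<open>P\<close> gives exact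
    distances.\<close>
  have lip: "L2_quat_norm (\<lambda>w. T g w - T f w) \<le> L2_quat_norm (\<lambda>t. g t - f t)"
    if f: "f \<in> L2_quat" and g: "g \<in> L2_quat" for f g
  proof (rule field_le_epsilon)
    fix e :: real assume "e > 0"
    obtain a where a: "\<And>n. a n \<in> L1_quat \<inter> L2_quat" "(\<lambda>n. L2_quat_norm (\<lambda>t. a n t - f t)) \<longlonglongrightarrow> 0"
      using L2_quat_dense[OF f] by auto
    obtain n where n: "L2_quat_norm (\<lambda>t. a n t - f t) < e / 2"
      using order_tendstoD(2)[OF a(2), of "e / 2"] \<open>e > 0\<close> by (auto dest: eventually_happens)
    define h where "h = a n"
    have h: "h \<in> L1_quat \<inter> L2_quat" "h \<in> L2_quat" "L2_quat_norm (\<lambda>t. h t - f t) < e / 2"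
      using a(1)[of n] n by (auto simp: h_def)
    have Fh: "qft_L1 I h \<in> L2_quat" using qft_L1_plancherel(1)[OF I] h by simp
    have "L2_quat_norm (\<lambda>w. T g w - T f w) \<le>
        L2_quat_norm (\<lambda>w. qft_L1 I h w - T g w) + L2_quat_norm (\<lambda>w. qft_L1 I h w - T f w)"
      using L2_quat_norm_diff_triangle[OF TL2[OF g] Fh TL2[OF f]] by (simp add: L2_quat_norm_minus_commute[of "T g"])
    also have "\<dots> = L2_quat_norm (\<lambda>t. h t - g t) + L2_quat_norm (\<lambda>t. h t - f t)"
      using PT[OF f] PT[OF g] h(1) by (simp add: P_def)
    also have "\<dots> \<le> L2_quat_norm (\<lambda>t. h t - f t) + L2_quat_norm (\<lambda>t. f t - g t) + L2_quat_norm (\<lambda>t. h t - f t)"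
      using L2_quat_norm_diff_triangle[OF h(2) f g] by simp
    also have "\<dots> \<le> L2_quat_norm (\<lambda>t. g t - f t) + e"
      using h(3) by (simp add: L2_quat_norm_minus_commute[of f])
    finally show "L2_quat_norm (\<lambda>w. T g w - T f w) \<le> L2_quat_norm (\<lambda>t. g t - f t) + e" .
  qed
  have "is_qft_extension I T"
    unfolding is_qft_extension_def L2_quat_continuous_def
  proof (intro conjI ballI allI impI)
    fix f and \<epsilon> :: real assume "f \<in> L2_quat" "0 < \<epsilon>"
    then show "\<exists>\<delta>>0. \<forall>g\<in>L2_quat. L2_quat_norm (\<lambda>t. g t - f t) < \<delta> \<longrightarrow> L2_quat_norm (\<lambda>t. T g t - T f t) < \<epsilon>"
      using lip by (intro exI[of _ \<epsilon>]) (auto intro: le_less_trans)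
  next
    fix f assume "f \<in> L1_quat \<inter> L2_quat"
    then show "T f = qft_L1 I f" by (simp add: T_def)
  qed (rule TL2)
  then show ?thesis by blast
qed

text \<open>Only the defining properties of an extension enter, so the result covers whichever one
  \<open>SOME\<close> selects. Both sides are continuous along approximating sequences and agree on
  them.\<close>

lemma qft_extension_isometry:
  assumes I: "I \<in> quat_sphere" and T: "is_qft_extension I T" and f: "f \<in> L2_quat" and g: "g \<in> L2_quat"
  shows "L2_quat_norm (\<lambda>w. T f w - T g w * e) = L2_quat_norm (\<lambda>t. f t - g t * e)"
proof -
  have TL2: "T h \<in> L2_quat" if "h \<in> L2_quat" for h
    using T that by (simp add: is_qft_extension_def)
  have TF: "T h = qft_L1 I h" if "h \<in> L1_quat \<inter> L2_quat" for h
    using T that by (simp add: is_qft_extension_def)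
  have T_lim: "(\<lambda>n. L2_quat_norm (\<lambda>w. T (a n) w - T h w)) \<longlonglongrightarrow> 0"
    if h: "h \<in> L2_quat" and a: "\<And>n. a n \<in> L2_quat" "(\<lambda>n. L2_quat_norm (\<lambda>t. a n t - h t)) \<longlonglongrightarrow> 0" for a h
  proof (rule tendstoI)
    fix \<epsilon> :: real assume "\<epsilon> > 0"
    then obtain \<delta> where "\<delta> > 0"
      and \<delta>: "\<And>k. k \<in> L2_quat \<Longrightarrow> L2_quat_norm (\<lambda>t. k t - h t) < \<delta> \<Longrightarrow> L2_quat_norm (\<lambda>t. T k t - T h t) < \<epsilon>"
      using T h unfolding is_qft_extension_def L2_quat_continuous_def by metis
    have "eventually (\<lambda>n. L2_quat_norm (\<lambda>t. a n t - h t) < \<delta>) sequentially"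
      using order_tendstoD(2)[OF a(2) \<open>\<delta> > 0\<close>] .
    then show "eventually (\<lambda>n. dist (L2_quat_norm (\<lambda>w. T (a n) w - T h w)) 0 < \<epsilon>) sequentially"
      by eventually_elim (simp add: \<delta> a(1))
  qed
  obtain a where a: "\<And>n. a n \<in> L1_quat \<inter> L2_quat" "(\<lambda>n. L2_quat_norm (\<lambda>t. a n t - f t)) \<longlonglongrightarrow> 0"
    using L2_quat_dense[OF f] by auto
  obtain b where b: "\<And>n. b n \<in> L1_quat \<inter> L2_quat" "(\<lambda>n. L2_quat_norm (\<lambda>t. b n t - g t)) \<longlonglongrightarrow> 0"
    using L2_quat_dense[OF g] by auto
  have aL2: "a n \<in> L2_quat" and bL2: "b n \<in> L2_quat" for n
    using a(1)[of n] b(1)[of n] by auto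
  have "(\<lambda>n. L2_quat_norm (\<lambda>w. T (a n) w - T (b n) w * e)) \<longlonglongrightarrow> L2_quat_norm (\<lambda>w. T f w - T g w * e)"
    by (intro L2_quat_norm_tendsto_diff_mult TL2 T_lim aL2 bL2 a b f g)
  moreover have "(\<lambda>n. L2_quat_norm (\<lambda>t. a n t - b n t * e)) \<longlonglongrightarrow> L2_quat_norm (\<lambda>t. f t - g t * e)"
    by (intro L2_quat_norm_tendsto_diff_mult aL2 bL2 a b f g)
  moreover have "L2_quat_norm (\<lambda>w. T (a n) w - T (b n) w * e) = L2_quat_norm (\<lambda>t. a n t - b n t * e)" for n
    by (simp only: TF[OF a(1)] TF[OF b(1)] L2_quat_norm_qft_L1_diff[OF I a(1) b(1)])
  ultimately show ?thesis
    using LIMSEQ_unique by fastforce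
qed

theorem theorem4p3:
  fixes I :: quat
  assumes "I \<in> quat_sphere"
  shows "(\<forall>\<phi>\<in>L2_quat. \<forall>\<psi>\<in>L2_quat.
           L2_quat_inner (qft I \<phi>) (qft I \<psi>) = L2_quat_inner \<phi> \<psi>) \<and>
         (\<forall>\<phi>\<in>L2_quat. L2_quat_norm (qft I \<phi>) = L2_quat_norm \<phi>)"
proof -
  have ext: "is_qft_extension I (qft I)"
    unfolding qft_def by (rule someI_ex[OF is_qft_extension_exists[OF assms]])
  then have L2: "qft I f \<in> L2_quat" if "f \<in> L2_quat" for f
    using that by (simp add: is_qft_extension_def)
  note iso = qft_extension_isometry[OF assms ext]
  \<comment> \<open>With \<open>e = 0\<close> the isometry becomes the norm identity. It is obtained
    before the inner product identity, whose polarization formula contains these norms.\<close>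
  have norm_eq: "L2_quat_norm (qft I f) = L2_quat_norm f" if "f \<in> L2_quat" for f
    using iso[OF that that, of 0] by simp
  moreover have "L2_quat_inner (qft I f) (qft I g) = L2_quat_inner f g"
    if "f \<in> L2_quat" "g \<in> L2_quat" for f g
    by (rule euclidean_eqI)
      (simp add: inner_L2_quat_inner that L2 iso norm_eq L2_quat_norm_mult_right)
  ultimately show ?thesis by blast
qed

end
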